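(* There exist deterministic constants $C,c>0$ such that, for a.e. $(\mathbf a,\mathbf b)$, there exists $k_0=k_0^{\mathbf a,\mathbf b}\in\mathbb N$ such that $$\mathbf P_{\mathbf a,\mathbf b}\bigl(G(m_k,n_k)\ge n_k\gamma_{m_k,n_k}+n_ks\bigr)\le C\,e^{-cn_k\min\{s^{3/2},\,s\}}$$ for all $s>0$ and $k\ge k_0$.
   Context: Let $\mathbb N=\{1,2,\dots\}$ and $\mathbb Z_+=\{0,1,2,\dots\}$. Model: $\mathbf a=(a_n)_{n\in\mathbb N}$ and $\mathbf b=(b_n)_{n\in\mathbb N}$ are random sequences in $(0,1)$, each stationary and ergodic with respect to the shift $(c_n)\mapsto(c_{n+1})$; no assumption is made on their joint law. "A.e. $(\mathbf a,\mathbf b)$" refers to this joint law; "deterministic" means not depending on the realization of $(\mathbf a,\mathbf b)$. Given $(\mathbf a,\mathbf b)$, under $\mathbf P_{\mathbf a,\mathbf b}$ the weights $W(i,j)$, $i,j\in\mathbb N$, are independent, $\mathbb Z_+$-valued, with $\mathbf P_{\mathbf a,\mathbf b}(W(i,j)\ge k)=a_i^kb_j^k$ for $k\in\mathbb Z_+$. $G(m,n)=\max_\pi\sum_{(i,j)\in\pi}W(i,j)$, the maximum over directed paths $\pi$ from $(1,1)$ to $(m,n)$ (steps in $\{(1,0),(0,1)\}$). Let $\alpha,\beta$ be the distributions of $a_1,b_1$ and $\bar\alpha,\bar\beta$ the right endpoints of their supports. Standing assumptions: $\bar\alpha\bar\beta<1$, and $r$ is a fixed real number with $c_1<r<c_2$,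 where $$c_1=\frac{\int_0^1 b(1-b\bar\alpha)^{-2}\beta(db)}{\int_0^1a(\bar\alpha-a)^{-2}\alpha(da)},\qquad c_2=\frac{\int_0^1b(\bar\beta-b)^{-2}\beta(db)}{\int_0^1a(1-a\bar\beta)^{-2}\alpha(da)}$$ (with $1/\infty=0$, $1/0=\infty$). Moreover $(m_k)_{k\in\mathbb N}$, $(n_k)_{k\in\mathbb N}$ are fixed sequences in $\mathbb N$ with $n_k\to\infty$ and $m_k/n_k\to r$. For $m,n\in\mathbb N$, $\gamma_{m,n}=\gamma_{m,n}^{\mathbf a,\mathbf b}=\inf g_{m,n}(z)$, where $$g_{m,n}(z)=\frac1n\sum_{i=1}^m\frac{a_i}{z-a_i}+\frac1n\sum_{j=1}^n\frac{b_jz}{1-b_jz}$$ and the infimum is over real $z$ with $\max_{1\le i\le m}a_i<z<\min_{1\le j\le n}1/b_j$. *)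

theory Defs
  imports "HOL-Probability.Probability"
begin

(* All sequences are indexed by {1..}; index 0 never occurs.  Elements of space seq_space
   are extensional, i.e. undefined at index 0. *)
definition seq_space :: "(nat \<Rightarrow> real) measure" where
  "seq_space = (\<Pi>\<^sub>M i\<in>{1..}. borel)"

definition seq_shift :: "(nat \<Rightarrow> real) \<Rightarrow> nat \<Rightarrow> real" where
  "seq_shift c = (\<lambda>n\<in>{1..}. c (n + 1))"

definition stationary_law :: "(nat \<Rightarrow> real) measure \<Rightarrow> bool" where
  "stationary_law \<nu> \<longleftrightarrow> distr \<nu> seq_space seq_shift = \<nu>"

definition ergodic_law :: "(nat \<Rightarrow> real) measure \<Rightarrow> bool" where
  "ergodic_law \<nu> \<longleftrightarrow>
     (\<forall>A\<in>sets seq_space. seq_shift -` A \<inter> space seq_space = A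
        \<longrightarrow> measure \<nu> A = 0 \<or> measure \<nu> A = 1)"

definition unit_seqs :: "(nat \<Rightarrow> real) set" where
  "unit_seqs = (\<Pi>\<^sub>E i\<in>{1..}. {0<..<1})"

definition measure_support :: "real measure \<Rightarrow> real set" where
  "measure_support \<mu> = {x. \<forall>U. open U \<and> x \<in> U \<longrightarrow> emeasure \<mu> U > 0}"

definition right_endpoint :: "real measure \<Rightarrow> real" where
  "right_endpoint \<mu> = Sup (measure_support \<mu>)"

(* Both thresholds live in ennreal, where 1 / 0 = \<infinity> and 1 / \<infinity> = 0; an atom of alpha at
   its right endpoint makes the denominator of c1 infinite, and similarly for c2. *)
definition c1 :: "real measure \<Rightarrow> real measure \<Rightarrow> ennreal" where
  "c1 \<alpha> \<beta> =
     (\<integral>\<^sup>+b\<in>{0..1}. (ennreal b / ennreal ((1 - b * right_endpoint \<alpha>)\<^sup>2)) \<partial>\<beta>) /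
     (\<integral>\<^sup>+a\<in>{0..1}. (ennreal a / ennreal ((right_endpoint \<alpha> - a)\<^sup>2)) \<partial>\<alpha>)"

definition c2 :: "real measure \<Rightarrow> real measure \<Rightarrow> ennreal" where
  "c2 \<alpha> \<beta> =
     (\<integral>\<^sup>+b\<in>{0..1}. (ennreal b / ennreal ((right_endpoint \<beta> - b)\<^sup>2)) \<partial>\<beta>) /
     (\<integral>\<^sup>+a\<in>{0..1}. (ennreal a / ennreal ((1 - a * right_endpoint \<beta>)\<^sup>2)) \<partial>\<alpha>)"

definition geometric_weights ::
  "'w measure \<Rightarrow> (nat \<Rightarrow> nat \<Rightarrow> 'w \<Rightarrow> nat) \<Rightarrow> (nat \<Rightarrow> real) \<Rightarrow> (nat \<Rightarrow> real) \<Rightarrow> bool" where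
  "geometric_weights P W a b \<longleftrightarrow>
     prob_space P \<and>
     prob_space.indep_vars P (\<lambda>_. count_space UNIV) (\<lambda>(i, j). W i j) ({1..} \<times> {1..}) \<and>
     (\<forall>i\<ge>1. \<forall>j\<ge>1. \<forall>k. measure P {\<omega>\<in>space P. W i j \<omega> \<ge> k} = a i ^ k * b j ^ k)"

definition lattice_step :: "nat \<times> nat \<Rightarrow> nat \<times> nat \<Rightarrow> bool" where
  "lattice_step p q \<longleftrightarrow> q = (fst p + 1, snd p) \<or> q = (fst p, snd p + 1)"

definition directed_paths :: "nat \<Rightarrow> nat \<Rightarrow> (nat \<times> nat) list set" where
  "directed_paths m n =
     {\<pi>. \<pi> \<noteq> [] \<and> hd \<pi> = (1, 1) \<and> last \<pi> = (m, n) \<and> successively lattice_step \<pi>}"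

definition last_passage :: "(nat \<Rightarrow> nat \<Rightarrow> nat) \<Rightarrow> nat \<Rightarrow> nat \<Rightarrow> nat" where
  "last_passage w m n = Max ((\<lambda>\<pi>. \<Sum>(i, j)\<in>set \<pi>. w i j) ` directed_paths m n)"

definition g_fun :: "(nat \<Rightarrow> real) \<Rightarrow> (nat \<Rightarrow> real) \<Rightarrow> nat \<Rightarrow> nat \<Rightarrow> real \<Rightarrow> real" where
  "g_fun a b m n z =
     1 / real n * (\<Sum>i=1..m. a i / (z - a i)) + 1 / real n * (\<Sum>j=1..n. b j * z / (1 - b j * z))"

(* For sequences in (0,1) and m, n > 0 the interval contains 1 and g_fun is nonnegative on it,
   so the real infimum is a genuine one. *)
definition gamma_inf :: "(nat \<Rightarrow> real) \<Rightarrow> (nat \<Rightarrow> real) \<Rightarrow> nat \<Rightarrow> nat \<Rightarrow> real" where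
  "gamma_inf a b m n =
     (INF z\<in>{Max (a ` {1..m})<..<Min ((\<lambda>j. 1 / b j) ` {1..n})}. g_fun a b m n z)"

end

theory Submission
  imports Defs
begin

text \<open>
  The upper tail follows from a bound on exponential moments. Put
  \<open>L z = (\<Sum>i. ln (1 - a i / z)) - (\<Sum>j. ln (1 - b j * z))\<close>, so that the derivative of \<open>L\<close> in the variable
  \<open>ln z\<close> is \<open>n g(z)\<close>. For \<open>w < z\<close> in the parameter interval, the moment of \<open>(z / w) ^ G\<close> is at most
  \<open>exp (L z - L w)\<close> (\<open>last_passage_moment\<close>). To see this, put geometric weights with parameters \<open>a i / z\<close> and \<open>b j * z\<close>
  on the two axes. Then the increments of the passage times along every down-right path are independent and geometric, because
  the map at a single cell preserves such laws (\<open>geom_corner\<close>, \<open>corners_invariant\<close>). The model with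
  boundary dominates \<open>G\<close>, and its passage time is the sum of the vertical increments on the left side,
  independent of \<open>G\<close>, and of the horizontal ones on the top side, whose law is known.

  Let \<open>\<zeta>\<close> minimize \<open>g\<close> and take \<open>z = \<zeta> exp t\<close>, \<open>w = \<zeta> exp (- t)\<close>. Then \<open>L z - L w\<close> is the integral of
  \<open>n g(\<zeta> exp v)\<close> over \<open>v\<close> between \<open>- t\<close> and \<open>t\<close>, hence at most \<open>2 t n \<gamma>\<close> plus a cubic error \<open>n K t\<^sup>3\<close>. By Markov's
  inequality the probability of \<open>G \<ge> n \<gamma> + n s\<close> is at most \<open>exp (- 2 t n s + n K t\<^sup>3)\<close>. The choice
  \<open>t = min \<delta> (sqrt (s / K))\<close> yields the claim with \<open>C = 1\<close> (\<open>last_passage_tail_above\<close>).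

  It remains to choose \<open>\<delta>\<close> and \<open>K\<close> deterministically, that is, to keep \<open>\<zeta>\<close> in a fixed compact part of the
  interval between the right endpoint of the first law and the inverse of that of the second. The
  assumption on \<open>c1\<close> says that the limit of \<open>g'\<close> is negative at the left end, hence also at some \<open>z1\<close>
  inside (\<open>threshold_parameter\<close>); the one on \<open>c2\<close> gives \<open>z2\<close> with the opposite sign. By the ergodic theorem
  (\<open>ergodic_seq_average\<close>) the signs are correct for \<open>g\<close> itself when \<open>k\<close> is large, and by convexity a minimizer
  lies between \<open>z1\<close> and \<open>z2\<close> (\<open>gamma_inf_attained\<close>).
\<close>

section \<open>A corner of the stationary growth model\<close>

text \<open>
  Parametrized by the ratio of the weights, so that the tail at \<open>k\<close> is \<open>q ^ k\<close> and the parameters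
  of the corner below multiply.
\<close>

definition geom :: "real \<Rightarrow> nat pmf" where
  "geom q = geometric_pmf (1 - q)"

lemma pmf_geom: "0 < q \<Longrightarrow> q < 1 \<Longrightarrow> pmf (geom q) k = q ^ k * (1 - q)"
  by (simp add: geom_def)

lemma nn_integral_geom_power:
  assumes "0 < q" "q < 1" "0 \<le> y" "y * q < 1"
  shows "(\<integral>\<^sup>+k. ennreal (y ^ k) \<partial>geom q) = ennreal ((1 - q) / (1 - y * q))"
proof -
  have "(\<lambda>k. (1 - q) * (y * q) ^ k) sums ((1 - q) * (1 / (1 - y * q)))"
    using assms by (intro sums_mult geometric_sums) auto
  then have s: "(\<lambda>k. (1 - q) * (y * q) ^ k) sums ((1 - q) / (1 - y * q))"
    by simp
  have "(\<integral>\<^sup>+k. ennreal (y ^ k) \<partial>geom q) = (\<integral>\<^sup>+k. ennreal ((1 - q) * (y * q) ^ k) \<partial>count_space UNIV)"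
    using assms
    by (subst nn_integral_measure_pmf)
      (auto intro!: nn_integral_cong simp: pmf_geom ennreal_mult' [symmetric] power_mult_distrib mult_ac)
  also have "\<dots> = (\<Sum>k. ennreal ((1 - q) * (y * q) ^ k))"
    by (rule nn_integral_count_space_nat)
  also have "\<dots> = ennreal ((1 - q) / (1 - y * q))"
    using assms s by (intro suminf_ennreal_eq) auto
  finally show ?thesis .
qed

text \<open>
  Burke's property for one cell. With \<open>x\<close> and \<open>y\<close> the increments entering the cell along its bottom
  and left edges and \<open>k\<close> the weight, the increments leaving along the top and right edges are
  \<open>x - y + k\<close> and \<open>y - x + k\<close>, where truncated subtraction is the positive part. Remembering
  \<open>min x y\<close> as a third coordinate turns this map into an involution of triples. The law of
  \<open>(x, y, k)\<close> has density proportional to \<open>p ^ (x + k) * q ^ (y + k)\<close>, and these exponents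
  are preserved by the involution because \<open>x = (x - y) + min x y\<close>; so the law is invariant.
\<close>

lemma geom_corner:
  assumes p: "0 < p" "p < 1" and q: "0 < q" "q < 1"
  shows "do {x \<leftarrow> geom p; y \<leftarrow> geom q; k \<leftarrow> geom (p * q); return_pmf (x - y + k, y - x + k)}
    = do {x \<leftarrow> geom p; y \<leftarrow> geom q; return_pmf (x, y)}"
proof -
  have pq: "0 < p * q" "p * q < 1"
    using assms mult_strict_mono[of p 1 q 1] by auto
  define \<mu> where "\<mu> = pair_pmf (geom p) (pair_pmf (geom q) (geom (p * q)))"
  define T :: "nat \<times> nat \<times> nat \<Rightarrow> nat \<times> nat \<times> nat"
    where "T = (\<lambda>(x, y, k). (x - y + k, y - x + k, min x y))"
  have inv: "T (T z) = z" for z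
    by (cases z) (auto simp: T_def min_def)
  have weight: "pmf \<mu> (T z) = pmf \<mu> z" for z
  proof (cases z)
    case (fields x y k)
    have pw: "p ^ (x - y + k) * q ^ (y - x + k) * (p * q) ^ min x y = p ^ x * q ^ y * (p * q) ^ k"
    proof -
      have "p ^ (x - y + k) * q ^ (y - x + k) * (p * q) ^ min x y
          = p ^ (x - y + min x y) * q ^ (y - x + min x y) * (p * q) ^ k"
        by (simp add: power_add power_mult_distrib mult_ac)
      moreover have "x - y + min x y = x" "y - x + min x y = y"
        by (auto simp: min_def)
      ultimately show ?thesis by simp
    qed
    show ?thesis
      using pw p q pq by (simp add: fields \<mu>_def T_def pmf_pair pmf_geom mult_ac)
  qed
  have T_inj: "inj T"
    by (metis inv injI)
  have map_T: "map_pmf T \<mu> = \<mu>"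
  proof (rule pmf_eqI)
    fix z
    have "pmf (map_pmf T \<mu>) (T (T z)) = pmf \<mu> (T z)"
      by (rule pmf_map_inj') (rule T_inj)
    then show "pmf (map_pmf T \<mu>) z = pmf \<mu> z"
      by (simp add: inv weight)
  qed
  have "do {x \<leftarrow> geom p; y \<leftarrow> geom q; k \<leftarrow> geom (p * q); return_pmf (x - y + k, y - x + k)}
      = map_pmf (\<lambda>(x, y, k). (x, y)) (map_pmf T \<mu>)"
    by (simp add: \<mu>_def T_def pair_pmf_def map_pmf_def bind_assoc_pmf bind_return_pmf)
  also have "\<dots> = map_pmf (\<lambda>(x, y, k). (x, y)) \<mu>"
    by (simp add: map_T)
  also have "\<dots> = do {x \<leftarrow> geom p; y \<leftarrow> geom q; return_pmf (x, y)}"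
    by (simp add: \<mu>_def pair_pmf_def map_pmf_def bind_assoc_pmf bind_return_pmf)
  finally show ?thesis .
qed

section \<open>Invariance of the increments along all corners\<close>

type_synonym increments = "(nat \<Rightarrow> nat) \<times> (nat \<Rightarrow> nat)"

text \<open>
  The state holds the current horizontal increment of every column and vertical increment of every
  row; filling cell \<open>(i, j)\<close> changes those of column \<open>i\<close> and row \<open>j\<close> only.
\<close>

fun corner :: "nat \<times> nat \<Rightarrow> nat \<Rightarrow> increments \<Rightarrow> increments" where
  "corner (i, j) k (I, J) = (I(i := I i - J j + k), J(j := J j - I i + k))"

fun corners :: "(nat \<times> nat \<Rightarrow> nat) \<Rightarrow> (nat \<times> nat) list \<Rightarrow> increments \<Rightarrow> increments" where
  "corners w [] s = s"
| "corners w (p # ps) s = corners w ps (corner p (w p) s)"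

lemma corners_append: "corners w (ps @ qs) s = corners w qs (corners w ps s)"
  by (induction ps arbitrary: s) auto

lemma corners_cong: "(\<And>p. p \<in> set ps \<Longrightarrow> w p = w' p) \<Longrightarrow> corners w ps s = corners w' ps s"
  by (induction ps arbitrary: s) auto

text \<open>
  The stationary law of the increments along the growth interface, a down-right path.
\<close>

definition increments_law ::
  "nat set \<Rightarrow> nat set \<Rightarrow> (nat \<Rightarrow> real) \<Rightarrow> (nat \<Rightarrow> real) \<Rightarrow> increments pmf" where
  "increments_law A B u v =
     pair_pmf (Pi_pmf A 0 (\<lambda>i. geom (u i))) (Pi_pmf B 0 (\<lambda>j. geom (v j)))"

lemma corner_invariant:
  assumes fin: "finite A" "finite B" and ij: "i \<in> A" "j \<in> B"
    and u: "0 < u i" "u i < 1" and v: "0 < v j" "v j < 1"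
  shows "do {s \<leftarrow> increments_law A B u v; k \<leftarrow> geom (u i * v j); return_pmf (corner (i, j) k s)}
    = increments_law A B u v"
proof -
  define A' B' where "A' = A - {i}" and "B' = B - {j}"
  have A: "A = insert i A'" "finite A'" "i \<notin> A'" and B: "B = insert j B'" "finite B'" "j \<notin> B'"
    using fin ij by (auto simp: A'_def B'_def)
  define R S where "R = Pi_pmf A' 0 (\<lambda>i. geom (u i))" and "S = Pi_pmf B' 0 (\<lambda>j. geom (v j))"
  have split: "increments_law A B u v = do {f \<leftarrow> R; g \<leftarrow> S; 
      (x, y) \<leftarrow> do {x \<leftarrow> geom (u i); y \<leftarrow> geom (v j); return_pmf (x, y)};
      return_pmf (f(i := x), g(j := y))}"
  proof -
    have "increments_law A B u v = do {x \<leftarrow> geom (u i); f \<leftarrow> R; y \<leftarrow> geom (v j); g \<leftarrow> S;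
        return_pmf (f(i := x), g(j := y))}"
      unfolding increments_law_def A(1) B(1) R_def S_def
      by (simp add: Pi_pmf_insert' A B pair_pmf_def bind_assoc_pmf bind_return_pmf)
    also have "\<dots> = do {f \<leftarrow> R; x \<leftarrow> geom (u i); y \<leftarrow> geom (v j); g \<leftarrow> S;
        return_pmf (f(i := x), g(j := y))}"
      by (rule bind_commute_pmf)
    also have "\<dots> = do {f \<leftarrow> R; x \<leftarrow> geom (u i); g \<leftarrow> S; y \<leftarrow> geom (v j); 
        return_pmf (f(i := x), g(j := y))}"
      by (intro bind_pmf_cong refl bind_commute_pmf)
    also have "\<dots> = do {f \<leftarrow> R; g \<leftarrow> S; x \<leftarrow> geom (u i); y \<leftarrow> geom (v j); 
        return_pmf (f(i := x), g(j := y))}"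
      by (intro bind_pmf_cong refl bind_commute_pmf)
    finally show ?thesis
      by (simp add: bind_assoc_pmf bind_return_pmf)
  qed
  have "do {s \<leftarrow> increments_law A B u v; k \<leftarrow> geom (u i * v j); return_pmf (corner (i, j) k s)}
    = do {f \<leftarrow> R; g \<leftarrow> S; 
      (x, y) \<leftarrow> do {x \<leftarrow> geom (u i); y \<leftarrow> geom (v j); k \<leftarrow> geom (u i * v j); 
        return_pmf (x - y + k, y - x + k)};
      return_pmf (f(i := x), g(j := y))}"
    unfolding split by (simp add: bind_assoc_pmf bind_return_pmf)
  also have "\<dots> = increments_law A B u v"
    unfolding geom_corner[OF u v] split ..
  finally show ?thesis .
qed

text \<open>
  Filling the cells one after the other with fresh weights keeps the increments along the growth
  interface independent and geometric. The weights are drawn together, as one product law, which is the form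
  needed to compare with the weights of the original model.
\<close>

lemma corners_invariant:
  assumes fin: "finite A" "finite B" and ps: "distinct ps" "set ps \<subseteq> A \<times> B"
    and u: "\<And>i. i \<in> A \<Longrightarrow> 0 < u i \<and> u i < 1" and v: "\<And>j. j \<in> B \<Longrightarrow> 0 < v j \<and> v j < 1"
  shows "do {s \<leftarrow> increments_law A B u v; w \<leftarrow> Pi_pmf (set ps) 0 (\<lambda>(i, j). geom (u i * v j));
      return_pmf (corners w ps s)} = increments_law A B u v"
  using ps
proof (induction ps)
  case Nil
  then show ?case by (simp add: bind_return_pmf bind_return_pmf')
next
  case (Cons p ps)
  obtain i j where p: "p = (i, j)" by (cases p)
  let ?\<rho> = "\<lambda>(i, j). geom (u i * v j)"
  have cong: "corners (w(p := k)) ps s = corners w ps s" for w k s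
    using Cons.prems by (intro corners_cong) auto
  have "do {s \<leftarrow> increments_law A B u v; w \<leftarrow> Pi_pmf (set (p # ps)) 0 ?\<rho>;
      return_pmf (corners w (p # ps) s)}
    = do {s \<leftarrow> do {s \<leftarrow> increments_law A B u v; k \<leftarrow> geom (u i * v j); return_pmf (corner (i, j) k s)};
        w \<leftarrow> Pi_pmf (set ps) 0 ?\<rho>; return_pmf (corners w ps s)}"
    using Cons.prems
    by (simp add: Pi_pmf_insert' bind_assoc_pmf bind_return_pmf cong) (simp add: p)
  also have "\<dots> = increments_law A B u v"
    using Cons by (subst corner_invariant) (use fin u v p in auto)
  finally show ?case .
qed

section \<open>Comparison of the two last passage times\<close>

text \<open>
  The last passage time when the axes carry the weights \<open>I\<close> and \<open>J\<close>, in recursive form.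
\<close>

function boundary_lpp :: "(nat \<Rightarrow> nat) \<Rightarrow> (nat \<Rightarrow> nat) \<Rightarrow> (nat \<times> nat \<Rightarrow> nat) \<Rightarrow> nat \<Rightarrow> nat \<Rightarrow> nat" where
  "boundary_lpp I J w i 0 = (\<Sum>i'=1..i. I i')"
| "boundary_lpp I J w 0 (Suc j) = (\<Sum>j'=1..Suc j. J j')"
| "boundary_lpp I J w (Suc i) (Suc j) =
     max (boundary_lpp I J w i (Suc j)) (boundary_lpp I J w (Suc i) j) + w (Suc i, Suc j)"
  by pat_completeness auto
termination
  by (relation "Wellfounded.measure (\<lambda>(I, J, w, i, j). i + j)") auto

declare boundary_lpp.simps [simp del]

lemma boundary_lpp_0: "boundary_lpp I J w 0 j = (\<Sum>j'=1..j. J j')"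
  by (cases j) (auto simp: boundary_lpp.simps)

fun row_sites :: "nat \<Rightarrow> nat \<Rightarrow> (nat \<times> nat) list" where
  "row_sites j 0 = []"
| "row_sites j (Suc i) = row_sites j i @ [(Suc i, j)]"

fun box_sites :: "nat \<Rightarrow> nat \<Rightarrow> (nat \<times> nat) list" where
  "box_sites m 0 = []"
| "box_sites m (Suc j) = box_sites m j @ row_sites (Suc j) m"

lemma set_row_sites: "set (row_sites j m) = {1..m} \<times> {j}"
  by (induction m) (simp_all add: atLeastAtMostSuc_conv)

lemma distinct_row_sites: "distinct (row_sites j m)"
  by (induction m) (simp_all add: set_row_sites)

lemma set_box_sites: "set (box_sites m n) = {1..m} \<times> {1..n}"
  by (induction n) (simp, simp add: set_row_sites atLeastAtMostSuc_conv, blast)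
 
lemma distinct_box_sites: "distinct (box_sites m n)"
  by (induction n) (simp_all add: set_row_sites distinct_row_sites set_box_sites Times_Int_Times)

text \<open>
  Filling the cells row by row keeps track of the last passage times with boundary: after \<open>k\<close> cells of
  row \<open>Suc j\<close>, the columns up to \<open>k\<close> hold the increments of the new row, the later columns those of the
  old row, and row \<open>Suc j\<close> holds the vertical increment between them at column \<open>k\<close>.
\<close>

lemma corners_row:
  assumes s: "corners w ps (I, J) = (I1, J1)"
    and I1: "\<forall>i. 1 \<le> i \<and> i \<le> m \<longrightarrow> boundary_lpp I J w (i - 1) j + I1 i = boundary_lpp I J w i j"
    and J1: "\<forall>j'. j < j' \<longrightarrow> J1 j' = J j'"
    and "k \<le> m"
  shows "\<exists>I2 J2. corners w (ps @ row_sites (Suc j) k) (I, J) = (I2, J2) \<and>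
    (\<forall>i. 1 \<le> i \<and> i \<le> k \<longrightarrow> boundary_lpp I J w (i - 1) (Suc j) + I2 i = boundary_lpp I J w i (Suc j)) \<and>
    (\<forall>i. k < i \<and> i \<le> m \<longrightarrow> boundary_lpp I J w (i - 1) j + I2 i = boundary_lpp I J w i j) \<and>
    boundary_lpp I J w k j + J2 (Suc j) = boundary_lpp I J w k (Suc j) \<and>
    (\<forall>j'. Suc j < j' \<longrightarrow> J2 j' = J j')"
  using \<open>k \<le> m\<close>
proof (induction k)
  case 0
  show ?case
    using s I1 J1
    by (intro exI[of _ I1] exI[of _ J1] conjI) (simp_all add: boundary_lpp_0)
next
  case (Suc k)
  let ?H = "boundary_lpp I J w"
  obtain I2 J2 where
    run: "corners w (ps @ row_sites (Suc j) k) (I, J) = (I2, J2)" and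
    new: "\<forall>i. 1 \<le> i \<and> i \<le> k \<longrightarrow> ?H (i - 1) (Suc j) + I2 i = ?H i (Suc j)" and
    old: "\<forall>i. k < i \<and> i \<le> m \<longrightarrow> ?H (i - 1) j + I2 i = ?H i j" and
    edge: "?H k j + J2 (Suc j) = ?H k (Suc j)" and
    above: "\<forall>j'. Suc j < j' \<longrightarrow> J2 j' = J j'"
    using Suc.IH[OF Suc_leD[OF Suc.prems]] by (elim exE conjE) (rule that)
  define x y where "x = I2 (Suc k)" and "y = J2 (Suc j)"
  define I3 J3 where "I3 = I2(Suc k := x - y + w (Suc k, Suc j))"
    and "J3 = J2(Suc j := y - x + w (Suc k, Suc j))"
  have H1: "?H k j + x = ?H (Suc k) j" and H2: "?H k j + y = ?H k (Suc j)"
    using old[rule_format, of "Suc k"] edge Suc.prems by (simp_all add: x_def y_def)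
  have f1: "corners w (ps @ row_sites (Suc j) (Suc k)) (I, J) = (I3, J3)"
    using run by (simp add: corners_append I3_def J3_def x_def y_def)
  have f2: "?H (i - 1) (Suc j) + I3 i = ?H i (Suc j)" if "1 \<le> i \<and> i \<le> Suc k" for i
  proof (cases "i = Suc k")
    case True
    then show ?thesis
      using H1 H2 by (simp add: I3_def boundary_lpp.simps max_def split: if_split) linarith
  next
    case False
    then show ?thesis
      using new[rule_format, of i] that by (simp add: I3_def)
  qed
  have f3: "?H (i - 1) j + I3 i = ?H i j" if "Suc k < i \<and> i \<le> m" for i
    using that old[rule_format, of i] by (simp add: I3_def)
  have f4: "?H (Suc k) j + J3 (Suc j) = ?H (Suc k) (Suc j)"
    using H1 H2 by (simp add: J3_def boundary_lpp.simps max_def split: if_split) linarith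
  have f5: "J3 j' = J j'" if "Suc j < j'" for j'
    using that above[rule_format, of j'] by (simp add: J3_def)
  show ?case
    by (rule exI[of _ I3], rule exI[of _ J3], intro conjI allI impI; (rule f1 f2 f3 f4 f5)?)
qed

lemma corners_box:
  "\<exists>I' J'. corners w (box_sites m n) (I, J) = (I', J') \<and>
    (\<forall>i. 1 \<le> i \<and> i \<le> m \<longrightarrow> boundary_lpp I J w (i - 1) n + I' i = boundary_lpp I J w i n) \<and>
    (\<forall>j. n < j \<longrightarrow> J' j = J j)"
proof (induction n)
  case 0
  have "boundary_lpp I J w (i - 1) 0 + I i = boundary_lpp I J w i 0" if "1 \<le> i" for i
    using that by (cases i) (auto simp: boundary_lpp.simps)
  then show ?case
    by (intro exI[of _ I] exI[of _ J] conjI allI impI) auto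
next
  case (Suc n)
  then obtain I' J' where run: "corners w (box_sites m n) (I, J) = (I', J')"
    and I': "\<forall>i. 1 \<le> i \<and> i \<le> m \<longrightarrow> boundary_lpp I J w (i - 1) n + I' i = boundary_lpp I J w i n"
    and J': "\<forall>j. n < j \<longrightarrow> J' j = J j"
    by (elim exE conjE) (rule that)
  obtain I2 J2 where
    "corners w (box_sites m n @ row_sites (Suc n) m) (I, J) = (I2, J2)"
    "\<forall>i. 1 \<le> i \<and> i \<le> m \<longrightarrow> boundary_lpp I J w (i - 1) (Suc n) + I2 i = boundary_lpp I J w i (Suc n)"
    "\<forall>j. Suc n < j \<longrightarrow> J2 j = J j"
    using corners_row[where m = m and k = m, OF run I' J' order.refl]
    by (elim exE conjE) (rule that)
  then show ?case
    unfolding box_sites.simps by (intro exI[of _ I2] exI[of _ J2] conjI)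
qed

lemma sum_final_increments:
  "(\<Sum>j=1..n. J j) + (\<Sum>i=1..m. fst (corners w (box_sites m n) (I, J)) i) = boundary_lpp I J w m n"
proof -
  obtain I' J' where run: "corners w (box_sites m n) (I, J) = (I', J')" and
    I': "\<forall>i. 1 \<le> i \<and> i \<le> m \<longrightarrow> boundary_lpp I J w (i - 1) n + I' i = boundary_lpp I J w i n"
    using corners_box[of w m n I J] by (elim exE conjE) (rule that)
  have "(\<Sum>j=1..n. J j) + (\<Sum>i=1..k. I' i) = boundary_lpp I J w k n" if "k \<le> m" for k
    using that
  proof (induction k)
    case 0
    then show ?case by (simp add: boundary_lpp_0)
  next
    case (Suc k)
    then show ?case using I'[rule_format, of "Suc k"] by simp
  qed
  then show ?thesis by (simp add: run)
qed

lemma boundary_lpp_step: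
  assumes "1 \<le> fst p" "1 \<le> snd p" "lattice_step p q"
  shows "boundary_lpp I J w (fst p) (snd p) + w q \<le> boundary_lpp I J w (fst q) (snd q)"
  using assms by (cases p; cases "fst p"; cases "snd p") (auto simp: lattice_step_def boundary_lpp.simps)

text \<open>
  Along a path the boundary model grows at each step by at least the weight collected there, so no path
  collects more than the passage time with boundary.
\<close>

lemma directed_path_prefix:
  assumes "\<pi> \<noteq> []" "hd \<pi> = (1, 1)" "successively lattice_step \<pi>"
  shows "set \<pi> \<subseteq> {1..fst (last \<pi>)} \<times> {1..snd (last \<pi>)}"
    and "length \<pi> + 1 = fst (last \<pi>) + snd (last \<pi>)"
    and "(\<Sum>p\<in>set \<pi>. w p) \<le> boundary_lpp I J w (fst (last \<pi>)) (snd (last \<pi>))"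
proof -
  have "set \<pi> \<subseteq> {1..fst (last \<pi>)} \<times> {1..snd (last \<pi>)} \<and>
    length \<pi> + 1 = fst (last \<pi>) + snd (last \<pi>) \<and>
    (\<Sum>p\<in>set \<pi>. w p) \<le> boundary_lpp I J w (fst (last \<pi>)) (snd (last \<pi>))"
    using assms
  proof (induction \<pi> rule: rev_induct)
    case Nil
    then show ?case by simp
  next
    case (snoc q \<pi>)
    show ?case
    proof (cases "\<pi> = []")
      case True
      then show ?thesis using snoc.prems by (auto simp: boundary_lpp.simps)
    next
      case False
      define p where "p = last \<pi>"
      have step: "lattice_step p q"
        using snoc.prems False by (auto simp: successively_append_iff p_def)
      have IH: "set \<pi> \<subseteq> {1..fst p} \<times> {1..snd p}" "length \<pi> + 1 = fst p + snd p"
        "(\<Sum>p\<in>set \<pi>. w p) \<le> boundary_lpp I J w (fst p) (snd p)"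
        using snoc False by (auto simp: successively_append_iff p_def)
      have "p \<in> set \<pi>" using False by (simp add: p_def)
      then have p: "1 \<le> fst p" "1 \<le> snd p" using subsetD[OF IH(1)] by (simp_all add: mem_Times_iff)
      have le: "fst p \<le> fst q" "snd p \<le> snd q" and len: "fst q + snd q = fst p + snd p + 1"
        using step by (auto simp: lattice_step_def)
      have "set (\<pi> @ [q]) \<subseteq> {1..fst q} \<times> {1..snd q}"
      proof -
        have "{1..fst p} \<times> {1..snd p} \<subseteq> {1..fst q} \<times> {1..snd q}"
          using le by (intro Sigma_mono) simp_all
        moreover have "q \<in> {1..fst q} \<times> {1..snd q}"
          using le p by (simp add: mem_Times_iff)
        ultimately show ?thesis
          using IH(1) by simp
      qed
      moreover have "length (\<pi> @ [q]) + 1 = fst q + snd q"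
        using IH(2) len by simp
      moreover have "(\<Sum>p\<in>set (\<pi> @ [q]). w p) \<le> boundary_lpp I J w (fst q) (snd q)"
      proof -
        have "(\<Sum>p\<in>set (\<pi> @ [q]). w p) \<le> (\<Sum>p\<in>set \<pi>. w p) + w q"
          by (cases "q \<in> set \<pi>") (simp_all add: insert_absorb)
        also have "\<dots> \<le> boundary_lpp I J w (fst p) (snd p) + w q"
          using IH(3) by simp
        also have "\<dots> \<le> boundary_lpp I J w (fst q) (snd q)"
          by (rule boundary_lpp_step[OF p step])
        finally show ?thesis .
      qed
      ultimately show ?thesis
        by (simp only: last_snoc simp_thms)
    qed
  qed
  then show "set \<pi> \<subseteq> {1..fst (last \<pi>)} \<times> {1..snd (last \<pi>)}"
    and "length \<pi> + 1 = fst (last \<pi>) + snd (last \<pi>)"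
    and "(\<Sum>p\<in>set \<pi>. w p) \<le> boundary_lpp I J w (fst (last \<pi>)) (snd (last \<pi>))"
    by auto
qed

lemma directed_path_sites: "\<pi> \<in> directed_paths m n \<Longrightarrow> set \<pi> \<subseteq> {1..m} \<times> {1..n}"
  using directed_path_prefix(1)[of \<pi>] by (auto simp: directed_paths_def)

lemma finite_directed_paths: "finite (directed_paths m n)"
proof (rule finite_subset)
  show "directed_paths m n \<subseteq> {\<pi>. set \<pi> \<subseteq> {1..m} \<times> {1..n} \<and> length \<pi> = m + n - 1}"
    using directed_path_prefix(1,2) by (fastforce simp: directed_paths_def)
  show "finite {\<pi>. set \<pi> \<subseteq> {1..m} \<times> {1..n} \<and> length \<pi> = m + n - (1::nat)}"
    by (intro finite_lists_length_eq) auto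
qed

lemma directed_paths_extend:
  assumes "\<pi> \<in> directed_paths m n" "lattice_step (m, n) (m', n')"
  shows "\<pi> @ [(m', n')] \<in> directed_paths m' n'"
  using assms by (auto simp: directed_paths_def successively_append_iff)

lemma directed_paths_nonempty:
  assumes "1 \<le> m" "1 \<le> n"
  shows "directed_paths m n \<noteq> {}"
  using assms(2)
proof (induction n rule: dec_induct)
  case base
  show ?case
    using assms(1)
  proof (induction m rule: dec_induct)
    case base
    have "[(1, 1)] \<in> directed_paths 1 1" by (simp add: directed_paths_def)
    then show ?case by blast
  next
    case (step m)
    then show ?case
      using directed_paths_extend[of _ m 1 "Suc m" 1] by (force simp: lattice_step_def)
  qed
next
  case (step n)
  then show ?case
    using directed_paths_extend[of _ m n m "Suc n"] by (force simp: lattice_step_def)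
qed

lemma last_passage_cong:
  assumes "\<And>i j. i \<in> {1..m} \<Longrightarrow> j \<in> {1..n} \<Longrightarrow> w i j = w' i j"
  shows "last_passage w m n = last_passage w' m n"
proof -
  have "(\<Sum>(i, j)\<in>set \<pi>. w i j) = (\<Sum>(i, j)\<in>set \<pi>. w' i j)" if "\<pi> \<in> directed_paths m n" for \<pi>
    using directed_path_sites[OF that] assms by (intro sum.cong) auto
  then show ?thesis
    unfolding last_passage_def by (metis (no_types, lifting) image_cong)
qed

lemma last_passage_le_boundary_lpp:
  assumes "1 \<le> m" "1 \<le> n"
  shows "last_passage (\<lambda>i j. w (i, j)) m n \<le> boundary_lpp I J w m n"
proof -
  have "(\<Sum>(i, j)\<in>set \<pi>. w (i, j)) \<le> boundary_lpp I J w m n" if "\<pi> \<in> directed_paths m n" for \<pi>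
    using directed_path_prefix(3)[of \<pi> w I J] that by (auto simp: directed_paths_def)
  then show ?thesis
    unfolding last_passage_def
    using finite_directed_paths directed_paths_nonempty[OF assms]
    by (intro Max.boundedI) auto
qed

section \<open>The exponential moment\<close>

text \<open>
  The exponential moment bound that carries the theorem. The horizontal increments
  \<open>I'\<close> left after filling the box have the same product law as the initial ones, which gives the right-hand side.
  On the other hand, the last passage time without boundary is at most the one with boundary,
  which is the sum of the initial vertical increments \<open>J\<close> and of the \<open>I'\<close>. As \<open>J\<close> is independent of the weights,
  the factor \<open>x ^ (- \<Sum> J)\<close> integrates separately.
\<close>

lemma last_passage_moment:
  assumes mn: "1 \<le> m" "1 \<le> n" and x: "1 \<le> x"
    and u: "\<And>i. i \<in> {1..m} \<Longrightarrow> 0 < u i \<and> x * u i < 1"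
    and v: "\<And>j. j \<in> {1..n} \<Longrightarrow> 0 < v j \<and> v j < 1"
  shows "(\<integral>\<^sup>+w. ennreal (x ^ last_passage (\<lambda>i j. w (i, j)) m n)
        \<partial>Pi_pmf ({1..m} \<times> {1..n}) 0 (\<lambda>(i, j). geom (u i * v j)))
      * ennreal (\<Prod>j=1..n. (1 - v j) / (1 - v j / x))
    \<le> ennreal (\<Prod>i=1..m. (1 - u i) / (1 - x * u i))"
proof -
  have u': "0 < u i \<and> u i < 1" if "i \<in> {1..m}" for i
    using u[OF that] x mult_right_mono[of 1 x "u i"] by linarith
  have v': "v j / x < 1" if "j \<in> {1..n}" for j
    using v[OF that] x by (simp add: field_simps)
  let ?PI = "Pi_pmf {1..m} 0 (\<lambda>i. geom (u i))" and ?PJ = "Pi_pmf {1..n} 0 (\<lambda>j. geom (v j))"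
  let ?PW = "Pi_pmf ({1..m} \<times> {1..n}) 0 (\<lambda>(i, j). geom (u i * v j))"
  let ?G = "\<lambda>w. last_passage (\<lambda>i j. w (i, j)) m n"
  let ?L = "increments_law {1..m} {1..n} u v"
  have I: "(\<integral>\<^sup>+s. (\<Prod>i=1..m. ennreal (x ^ fst s i)) \<partial>?L)
      = ennreal (\<Prod>i=1..m. (1 - u i) / (1 - x * u i))"
  proof -
    have "(\<integral>\<^sup>+s. (\<Prod>i=1..m. ennreal (x ^ fst s i)) \<partial>?L)
        = (\<integral>\<^sup>+I. (\<Prod>i=1..m. ennreal (x ^ I i)) \<partial>map_pmf fst ?L)"
      by simp
    also have "map_pmf fst ?L = ?PI"
      by (simp add: increments_law_def map_fst_pair_pmf)
    also have "(\<integral>\<^sup>+I. (\<Prod>i=1..m. ennreal (x ^ I i)) \<partial>?PI)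
        = (\<Prod>i=1..m. \<integral>\<^sup>+k. ennreal (x ^ k) \<partial>geom (u i))"
      by (rule nn_integral_prod_Pi_pmf) simp
    also have "\<dots> = (\<Prod>i=1..m. ennreal ((1 - u i) / (1 - x * u i)))"
      using u u' x by (intro prod.cong nn_integral_geom_power) auto
    also have "\<dots> = ennreal (\<Prod>i=1..m. (1 - u i) / (1 - x * u i))"
      using u u' by (intro prod_ennreal divide_nonneg_nonneg) (auto simp: less_imp_le)
    finally show ?thesis .
  qed
  have J: "(\<integral>\<^sup>+s. (\<Prod>j=1..n. ennreal ((1 / x) ^ snd s j)) \<partial>?L)
      = ennreal (\<Prod>j=1..n. (1 - v j) / (1 - v j / x))"
  proof -
    have "(\<integral>\<^sup>+s. (\<Prod>j=1..n. ennreal ((1 / x) ^ snd s j)) \<partial>?L)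
        = (\<integral>\<^sup>+J. (\<Prod>j=1..n. ennreal ((1 / x) ^ J j)) \<partial>map_pmf snd ?L)"
      by simp
    also have "map_pmf snd ?L = ?PJ"
      by (simp add: increments_law_def map_snd_pair_pmf)
    also have "(\<integral>\<^sup>+J. (\<Prod>j=1..n. ennreal ((1 / x) ^ J j)) \<partial>?PJ)
        = (\<Prod>j=1..n. \<integral>\<^sup>+k. ennreal ((1 / x) ^ k) \<partial>geom (v j))"
      by (rule nn_integral_prod_Pi_pmf) simp
    also have "\<dots> = (\<Prod>j=1..n. ennreal ((1 - v j) / (1 - 1 / x * v j)))"
      using v v' x by (intro prod.cong nn_integral_geom_power) auto
    also have "\<dots> = ennreal (\<Prod>j=1..n. (1 - v j) / (1 - v j / x))"
      using v v' by (subst prod_ennreal) (auto intro!: divide_nonneg_nonneg simp: less_imp_le)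
    finally show ?thesis .
  qed
  have pointwise: "ennreal (x ^ ?G w) * (\<Prod>j=1..n. ennreal ((1 / x) ^ snd s j))
      \<le> (\<Prod>i=1..m. ennreal (x ^ fst (corners w (box_sites m n) s) i))" for s w
  proof -
    define K L where "K = (\<Sum>j=1..n. snd s j)"
      and "L = (\<Sum>i=1..m. fst (corners w (box_sites m n) s) i)"
    have "?G w \<le> K + L"
      using last_passage_le_boundary_lpp[OF mn, of w "fst s" "snd s"]
        sum_final_increments[of "snd s" n w m "fst s"]
      by (simp add: K_def L_def)
    then have "x ^ ?G w \<le> x ^ K * x ^ L"
      using x by (simp add: power_increasing power_add [symmetric])
    then have "x ^ ?G w * (1 / x) ^ K \<le> x ^ L"
      using x by (simp add: field_simps)
    moreover have "(\<Prod>j=1..n. ennreal ((1 / x) ^ snd s j)) = ennreal ((1 / x) ^ K)"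
      using x by (subst prod_ennreal) (auto simp: K_def power_sum)
    moreover have "(\<Prod>i=1..m. ennreal (x ^ fst (corners w (box_sites m n) s) i)) = ennreal (x ^ L)"
      using x by (subst prod_ennreal) (auto simp: L_def power_sum)
    ultimately show ?thesis
      using x by (simp add: ennreal_mult' [symmetric] ennreal_leI)
  qed
  have "(\<integral>\<^sup>+w. ennreal (x ^ ?G w) \<partial>?PW) * ennreal (\<Prod>j=1..n. (1 - v j) / (1 - v j / x))
      = (\<integral>\<^sup>+s. \<integral>\<^sup>+w. ennreal (x ^ ?G w) * (\<Prod>j=1..n. ennreal ((1 / x) ^ snd s j)) \<partial>?PW \<partial>?L)"
    by (subst J [symmetric]) (simp add: nn_integral_multc nn_integral_cmult)
  also have "\<dots> \<le> (\<integral>\<^sup>+s. \<integral>\<^sup>+w. (\<Prod>i=1..m. ennreal (x ^ fst (corners w (box_sites m n) s) i)) \<partial>?PW \<partial>?L)"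
    by (intro nn_integral_mono pointwise)
  also have "\<dots> = (\<integral>\<^sup>+s. (\<Prod>i=1..m. ennreal (x ^ fst s i))
      \<partial>measure_pmf (do {s \<leftarrow> ?L; w \<leftarrow> ?PW; return_pmf (corners w (box_sites m n) s)}))"
    by simp
  also have "do {s \<leftarrow> ?L; w \<leftarrow> ?PW; return_pmf (corners w (box_sites m n) s)} = ?L"
    using corners_invariant[of "{1..m}" "{1..n}" "box_sites m n" u v] u' v
    by (simp add: distinct_box_sites set_box_sites)
  finally show ?thesis
    by (simp only: I)
qed

text \<open>
  Finitely many independent variables with values in the naturals take countably many joint
  values, whose probabilities multiply; this moves an event to the product mass function.
\<close>

lemma prob_indep_eq_Pi_pmf:
  fixes X :: "'i \<Rightarrow> 'w \<Rightarrow> nat"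
  assumes P: "prob_space P" and indep: "prob_space.indep_vars P (\<lambda>_. count_space UNIV) X A"
    and A: "finite A" "A \<noteq> {}"
    and p: "\<And>i k. i \<in> A \<Longrightarrow> measure P {\<omega>\<in>space P. X i \<omega> = k} = pmf (p i) k"
  shows "measure P {\<omega>\<in>space P. Q (\<lambda>i. if i \<in> A then X i \<omega> else 0)}
    = measure_pmf.prob (Pi_pmf A 0 p) {f. Q f}"
proof -
  interpret prob_space P by (fact P)
  define V where "V = (\<lambda>\<omega> i. if i \<in> A then X i \<omega> else 0)"
  define D where "D = {f \<in> PiE_dflt A (0::nat) (\<lambda>_. UNIV). Q f}"
  have "countable (PiE_dflt A (0::nat) (\<lambda>_. UNIV))"
    unfolding dflt_image_PiE [symmetric] using A by (intro countable_image countable_PiE) auto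
  then have D: "countable D"
    unfolding D_def by (rule countable_subset [rotated]) auto
  have V_fiber: "{\<omega>\<in>space P. V \<omega> = f} = (\<Inter>i\<in>A. X i -` {f i} \<inter> space P)" if "f \<in> D" for f
    using that A by (auto simp: D_def V_def PiE_dflt_def fun_eq_iff)
  have rv: "X i \<in> measurable P (count_space UNIV)" if "i \<in> A" for i
    using indep that by (auto simp: indep_vars_def)
  have sets: "{\<omega>\<in>space P. V \<omega> = f} \<in> sets P" if "f \<in> D" for f
    unfolding V_fiber[OF that] using A rv by (intro sets.finite_INT measurable_sets) auto
  have fiber: "emeasure P {\<omega>\<in>space P. V \<omega> = f} = emeasure (Pi_pmf A 0 p) {f}" if f: "f \<in> D" for f
  proof -
    have "prob {\<omega>\<in>space P. V \<omega> = f} = (\<Prod>i\<in>A. prob (X i -` {f i} \<inter> space P))"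
      unfolding V_fiber[OF f] using indep A by (intro indep_varsD_finite) auto
    also have "\<dots> = (\<Prod>i\<in>A. pmf (p i) (f i))"
      using p by (intro prod.cong) (auto simp: vimage_def Int_def conj_commute)
    also have "\<dots> = pmf (Pi_pmf A 0 p) f"
      using f A by (subst pmf_Pi') (auto simp: D_def PiE_dflt_def)
    finally show ?thesis
      by (simp add: emeasure_eq_measure emeasure_pmf_single)
  qed
  have "emeasure P {\<omega>\<in>space P. Q (V \<omega>)} = emeasure P (\<Union>f\<in>D. {\<omega>\<in>space P. V \<omega> = f})"
    by (rule arg_cong[where f = "emeasure P"]) (auto simp: D_def V_def PiE_dflt_def)
  also have "\<dots> = (\<integral>\<^sup>+f. emeasure P {\<omega>\<in>space P. V \<omega> = f} \<partial>count_space D)"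
    using D sets by (intro emeasure_UN_countable) (auto simp: disjoint_family_on_def)
  also have "\<dots> = (\<integral>\<^sup>+f. emeasure (Pi_pmf A 0 p) {f} \<partial>count_space D)"
    using fiber by (intro nn_integral_cong) auto
  also have "\<dots> = emeasure (Pi_pmf A 0 p) (\<Union>f\<in>D. {f})"
    using D by (intro emeasure_UN_countable [symmetric]) (auto simp: disjoint_family_on_def)
  also have "\<dots> = emeasure (Pi_pmf A 0 p) {f. Q f}"
    using A set_Pi_pmf_subset[of A 0 p]
    by (intro emeasure_eq_AE) (auto simp: AE_measure_pmf_iff D_def PiE_dflt_def)
  finally show ?thesis
    by (simp add: V_def emeasure_eq_measure measure_pmf.emeasure_eq_measure)
qed

text \<open>
  Markov's inequality for the moment above. The factorization \<open>a i * b j = u i * v j\<close> is not unique; its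
  choice is the free parameter that is optimized later.
\<close>

lemma last_passage_tail:
  assumes W: "geometric_weights P W a b" and mn: "1 \<le> m" "1 \<le> n" and x: "1 \<le> x"
    and ab: "\<And>i j. i \<in> {1..m} \<Longrightarrow> j \<in> {1..n} \<Longrightarrow> a i * b j = u i * v j"
    and u: "\<And>i. i \<in> {1..m} \<Longrightarrow> 0 < u i \<and> x * u i < 1"
    and v: "\<And>j. j \<in> {1..n} \<Longrightarrow> 0 < v j \<and> v j < 1"
  shows "measure P {\<omega>\<in>space P. t \<le> real (last_passage (\<lambda>i j. W i j \<omega>) m n)}
    \<le> x powr (- t) * (\<Prod>i=1..m. (1 - u i) / (1 - x * u i)) * (\<Prod>j=1..n. (1 - v j / x) / (1 - v j))"
proof -
  define A where "A = {1..m} \<times> {1..n}"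
  have A: "finite A" "A \<noteq> {}" using mn by (auto simp: A_def)
  interpret prob_space P using W by (simp add: geometric_weights_def)
  have u': "0 < u i \<and> u i < 1" if "i \<in> {1..m}" for i
    using u[OF that] x mult_right_mono[of 1 x "u i"] by linarith
  have uv: "0 < u i * v j" "u i * v j < 1" if "i \<in> {1..m}" "j \<in> {1..n}" for i j
    using u'[OF that(1)] v[OF that(2)] mult_strict_mono[of "u i" 1 "v j" 1] by auto
  have v': "v j / x < 1" if "j \<in> {1..n}" for j
    using v[OF that] x by (simp add: field_simps)
  let ?X = "\<lambda>(i, j). W i j" and ?p = "\<lambda>(i, j). geom (u i * v j)"
  have "indep_vars (\<lambda>_. count_space UNIV) ?X ({1..} \<times> {1..})"
    using W by (simp add: geometric_weights_def)
  then have indep: "indep_vars (\<lambda>_. count_space UNIV) ?X A"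
    by (rule indep_vars_subset) (auto simp: A_def)
  have single: "measure P {\<omega>\<in>space P. ?X ij \<omega> = k} = pmf (?p ij) k" if "ij \<in> A" for ij k
  proof -
    obtain i j where ij: "ij = (i, j)" by (cases ij)
    with that have i: "i \<in> {1..m}" and j: "j \<in> {1..n}" by (auto simp: A_def)
    have [measurable]: "W i j \<in> measurable P (count_space UNIV)"
      using indep that by (auto simp: indep_vars_def ij)
    have tail: "prob {\<omega>\<in>space P. l \<le> W i j \<omega>} = (u i * v j) ^ l" for l
    proof -
      have "prob {\<omega>\<in>space P. l \<le> W i j \<omega>} = a i ^ l * b j ^ l"
        using W i j by (simp add: geometric_weights_def)
      then show ?thesis
        by (simp only: power_mult_distrib [symmetric] ab[OF i j])
    qed
    have "{\<omega>\<in>space P. W i j \<omega> = k} = {\<omega>\<in>space P. k \<le> W i j \<omega>} - {\<omega>\<in>space P. Suc k \<le> W i j \<omega>}"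
      by auto
    moreover have "prob ({\<omega>\<in>space P. k \<le> W i j \<omega>} - {\<omega>\<in>space P. Suc k \<le> W i j \<omega>})
        = prob {\<omega>\<in>space P. k \<le> W i j \<omega>} - prob {\<omega>\<in>space P. Suc k \<le> W i j \<omega>}"
      by (rule finite_measure_Diff) auto
    ultimately have "prob {\<omega>\<in>space P. W i j \<omega> = k} = (u i * v j) ^ k - (u i * v j) ^ Suc k"
      unfolding tail by simp
    then show ?thesis
      using uv[OF i j] by (simp add: ij pmf_geom algebra_simps)
  qed
  let ?D = "Pi_pmf A 0 ?p"
  let ?G = "\<lambda>w. last_passage (\<lambda>i j. w (i, j)) m n"
  have "measure P {\<omega>\<in>space P. t \<le> real (last_passage (\<lambda>i j. W i j \<omega>) m n)}
      = measure P {\<omega>\<in>space P. t \<le> real (?G (\<lambda>ij. if ij \<in> A then ?X ij \<omega> else 0))}"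
  proof -
    have "last_passage (\<lambda>i j. W i j \<omega>) m n = ?G (\<lambda>ij. if ij \<in> A then ?X ij \<omega> else 0)" for \<omega>
      by (rule last_passage_cong) (auto simp: A_def)
    then show ?thesis by simp
  qed
  also have "\<dots> = measure_pmf.prob ?D {w. t \<le> real (?G w)}"
    using prob_indep_eq_Pi_pmf[OF prob_space_axioms indep A single, of "\<lambda>w. t \<le> real (?G w)"] .
  finally have eq: "measure P {\<omega>\<in>space P. t \<le> real (last_passage (\<lambda>i j. W i j \<omega>) m n)}
      = measure_pmf.prob ?D {w. t \<le> real (?G w)}" .
  define U V where "U = (\<Prod>i=1..m. (1 - u i) / (1 - x * u i))"
    and "V = (\<Prod>j=1..n. (1 - v j) / (1 - v j / x))"
  have U: "0 \<le> U"
    unfolding U_def using u u' by (intro prod_nonneg divide_nonneg_nonneg ballI) (auto simp: less_imp_le)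
  have V: "0 < V"
    unfolding V_def using v v' by (intro prod_pos divide_pos_pos ballI) auto
  have "ennreal (x powr t) * emeasure ?D {w. t \<le> real (?G w)}
      = (\<integral>\<^sup>+w. ennreal (x powr t) * indicator {w. t \<le> real (?G w)} w \<partial>?D)"
    by (simp add: nn_integral_cmult)
  also have "\<dots> \<le> (\<integral>\<^sup>+w. ennreal (x ^ ?G w) \<partial>?D)"
  proof (rule nn_integral_mono)
    fix w
    show "ennreal (x powr t) * indicator {w. t \<le> real (?G w)} w \<le> ennreal (x ^ ?G w)"
      using x by (auto simp: indicator_def powr_realpow [symmetric] intro!: ennreal_leI powr_mono)
  qed
  finally have "ennreal (x powr t) * emeasure ?D {w. t \<le> real (?G w)} * ennreal V
      \<le> (\<integral>\<^sup>+w. ennreal (x ^ ?G w) \<partial>?D) * ennreal V"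
    by (rule mult_right_mono) simp
  also have "\<dots> \<le> ennreal U"
    unfolding U_def V_def A_def by (rule last_passage_moment[OF mn x u v])
  finally have "x powr t * measure_pmf.prob ?D {w. t \<le> real (?G w)} * V \<le> U"
    using U V by (simp add: measure_pmf.emeasure_eq_measure ennreal_mult' [symmetric])
  then have "measure_pmf.prob ?D {w. t \<le> real (?G w)} \<le> x powr (- t) * U * (1 / V)"
  proof -
    assume "x powr t * measure_pmf.prob ?D {w. t \<le> real (?G w)} * V \<le> U"
    then have "x powr (- t) * (x powr t * measure_pmf.prob ?D {w. t \<le> real (?G w)} * V) * (1 / V)
        \<le> x powr (- t) * U * (1 / V)"
      using V by (intro mult_right_mono mult_left_mono) auto
    moreover have "x powr (- t) * x powr t = 1"
      using x by (simp add: powr_add [symmetric])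
    ultimately show ?thesis
      using V by (simp add: mult.assoc [symmetric])
  qed
  also have "1 / V = (\<Prod>j=1..n. (1 - v j / x) / (1 - v j))"
    by (simp add: V_def prod_dividef)
  finally show ?thesis
    by (simp add: eq U_def)
qed

section \<open>The tail at a point of the parameter interval\<close>

text \<open>
  The function \<open>t \<mapsto> q / (exp t - q)\<close> is added to its mirror image, so the first order term in \<open>s\<close>
  cancels. With \<open>y = exp s\<close> the left-hand side is exactly
  \<open>q (1 + q) (y - 1)\<^sup>2 / ((1 - q) (1 - q y) (y - q))\<close>.
\<close>

lemma symmetric_difference_bound:
  fixes q \<theta> s :: real
  assumes q: "0 < q" "q < 1" and s: "0 \<le> s" "s \<le> 1" and \<theta>: "q * exp s \<le> \<theta>" "\<theta> < 1"
  shows "q * exp (- s) / (1 - q * exp (- s)) + q * exp s / (1 - q * exp s) - 2 * q / (1 - q)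
    \<le> 8 / (1 - \<theta>) ^ 3 * s\<^sup>2"
proof -
  define y where "y = exp s"
  have y1: "1 \<le> y" and qy: "q * y \<le> \<theta>"
    using s \<theta> by (auto simp: y_def)
  have "q * 1 \<le> q * y"
    using q y1 by (intro mult_left_mono) auto
  then have q\<theta>: "q \<le> \<theta>" using qy by simp
  have e: "exp (- s) = 1 / y"
    by (simp add: y_def exp_minus inverse_eq_divide)
  have pos: "0 < 1 - q" "0 < 1 - q * y" "0 < y - q" "0 < y" "0 < 1 - \<theta>"
    using q y1 qy \<theta> by auto
  have "q * (1 / y) / (1 - q * (1 / y)) = q / (y - q)"
    using pos by (simp add: field_simps)
  moreover have "q / (y - q) + q * y / (1 - q * y) - 2 * q / (1 - q)
      = q * (1 + q) * (y - 1)\<^sup>2 / ((1 - q) * (1 - q * y) * (y - q))"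
  proof -
    have "q / (y - q) - q / (1 - q) = q * (1 - y) / ((y - q) * (1 - q))"
      using pos by (simp add: field_simps)
    moreover have "q * y / (1 - q * y) - q / (1 - q) = q * (y - 1) / ((1 - q * y) * (1 - q))"
      using pos by (simp add: field_simps)
    moreover have "q * (1 - y) / ((y - q) * (1 - q)) + q * (y - 1) / ((1 - q * y) * (1 - q))
        = (q * (1 - y) * (1 - q * y) + q * (y - 1) * (y - q)) / ((1 - q) * (1 - q * y) * (y - q))"
      using pos by (simp add: add_divide_distrib mult.commute)
    moreover have "q * (1 - y) * (1 - q * y) + q * (y - 1) * (y - q) = q * (1 + q) * (y - 1)\<^sup>2"
      by (simp add: algebra_simps power2_eq_square)
    ultimately show ?thesis
      by simp
  qed
  moreover have "q * (1 + q) * (y - 1)\<^sup>2 / ((1 - q) * (1 - q * y) * (y - q))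
      \<le> 2 * (2 * s)\<^sup>2 / ((1 - \<theta>) * (1 - \<theta>) * (1 - \<theta>))"
  proof (rule frac_le)
    have "y - 1 \<le> s + s\<^sup>2"
      using exp_bound[OF s] by (simp add: y_def)
    also have "\<dots> \<le> 2 * s"
      using s by (simp add: power2_eq_square mult_left_le)
    finally have "(y - 1)\<^sup>2 \<le> (2 * s)\<^sup>2"
      using y1 by (intro power_mono) auto
    moreover have "q * (1 + q) \<le> 1 * 2"
      using q by (intro mult_mono) auto
    ultimately show "q * (1 + q) * (y - 1)\<^sup>2 \<le> 2 * (2 * s)\<^sup>2"
      using q by (intro mult_mono) auto
    show "(1 - \<theta>) * (1 - \<theta>) * (1 - \<theta>) \<le> (1 - q) * (1 - q * y) * (y - q)"
      using q\<theta> qy y1 pos by (intro mult_mono) auto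
    show "0 < (1 - \<theta>) * (1 - \<theta>) * (1 - \<theta>)"
      using pos by simp
  qed simp
  moreover have "2 * (2 * s)\<^sup>2 / ((1 - \<theta>) * (1 - \<theta>) * (1 - \<theta>)) = 8 / (1 - \<theta>) ^ 3 * s\<^sup>2"
    by (simp add: power3_eq_cube power2_eq_square)
  ultimately show ?thesis
    unfolding e y_def [symmetric] by linarith
qed

text \<open>
  The logarithm of the left-hand side vanishes at \<open>t = 0\<close>, and by the previous lemma its derivative in \<open>t\<close>
  exceeds \<open>2 q / (1 - q)\<close> by at most a quadratic term. Integration gives the cubic error.
\<close>

lemma ratio_bound:
  fixes q \<theta> t :: real
  assumes q: "0 < q" and t: "0 \<le> t" "t \<le> 1" and \<theta>: "q * exp t \<le> \<theta>" "\<theta> < 1"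
  shows "(1 - q * exp (- t)) / (1 - q * exp t) \<le> exp (2 * t * (q / (1 - q)) + 8 / (1 - \<theta>) ^ 3 * t ^ 3)"
proof -
  have qs: "q * exp s \<le> \<theta>" if "s \<le> t" for s
    using \<theta> that q by (meson exp_le_cancel_iff mult_left_mono less_imp_le order_trans)
  have q1: "q < 1"
    using qs[of 0] t \<theta> by simp
  have pos: "0 < 1 - q * exp s" "0 < 1 - q * exp (- s)" if "0 \<le> s" "s \<le> t" for s
    using qs[of s] qs[of "- s"] that \<theta> by auto
  define c where "c = 8 / (1 - \<theta>) ^ 3"
  have c: "0 \<le> c" using \<theta> by (simp add: c_def)
  define h where "h = (\<lambda>s. ln (1 - q * exp (- s)) - ln (1 - q * exp s) - 2 * s * (q / (1 - q)) - c * s ^ 3)"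
  have "h t \<le> h 0"
  proof (rule DERIV_nonpos_imp_nonincreasing[OF t(1)])
    fix s assume s: "0 \<le> s" "s \<le> t"
    define D where "D = q * exp (- s) / (1 - q * exp (- s)) + q * exp s / (1 - q * exp s)
      - 2 * q / (1 - q) - 3 * c * s\<^sup>2"
    have "(h has_real_derivative D) (at s)"
      unfolding h_def D_def using pos[OF s] q1
      by (auto intro!: derivative_eq_intros simp: divide_simps)
    moreover have "D \<le> 0"
      using symmetric_difference_bound[OF q q1 s(1) order.trans[OF s(2) t(2)] qs[OF s(2)] \<theta>(2), folded c_def]
        mult_nonneg_nonneg[OF c, of "s\<^sup>2"]
      unfolding D_def by simp
    ultimately show "\<exists>y. (h has_real_derivative y) (at s) \<and> y \<le> 0"
      by blast
  qed
  then have "ln (1 - q * exp (- t)) - ln (1 - q * exp t) \<le> 2 * t * (q / (1 - q)) + c * t ^ 3"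
    by (simp add: h_def)
  moreover have "ln ((1 - q * exp (- t)) / (1 - q * exp t)) = ln (1 - q * exp (- t)) - ln (1 - q * exp t)"
    using pos[OF t(1) order.refl] by (simp add: ln_div)
  moreover have "0 < (1 - q * exp (- t)) / (1 - q * exp t)"
    using pos[OF t(1) order.refl] by simp
  ultimately show ?thesis
    by (metis c_def exp_le_cancel_iff exp_ln)
qed

text \<open>
  The symmetric choice \<open>u i = a i / (z exp t)\<close>, \<open>v j = b j z exp t\<close>, \<open>x = exp (2 t)\<close> makes every factor of
  the tail bound a ratio \<open>(1 - q exp (- t)) / (1 - q exp t)\<close> with \<open>q = a i / z\<close> or \<open>q = b j z\<close>, and the
  linear parts \<open>q / (1 - q)\<close> of their logarithms add up to \<open>n g(z)\<close>.
\<close>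

lemma last_passage_tail_exp:
  assumes W: "geometric_weights P W a b" and mn: "1 \<le> m" "1 \<le> n"
    and a: "\<And>i. i \<in> {1..m} \<Longrightarrow> 0 < a i \<and> a i \<le> \<theta>0 * z"
    and b: "\<And>j. j \<in> {1..n} \<Longrightarrow> 0 < b j \<and> b j * z \<le> \<theta>0"
    and z: "0 < z" and t: "0 \<le> t" "t \<le> 1" and \<theta>: "\<theta>0 * exp t \<le> \<theta>" "\<theta> < 1"
  shows "measure P {\<omega>\<in>space P. x \<le> real (last_passage (\<lambda>i j. W i j \<omega>) m n)}
    \<le> exp (- 2 * t * x + 2 * t * (real n * g_fun a b m n z) + (real m + real n) * (8 / (1 - \<theta>) ^ 3 * t ^ 3))"
proof -
  define p q where "p = (\<lambda>i. a i / z)" and "q = (\<lambda>j. b j * z)"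
  have p: "0 < p i" "p i * exp t \<le> \<theta>" if "i \<in> {1..m}" for i
  proof -
    have "p i \<le> \<theta>0" using a[OF that] z by (simp add: p_def field_simps)
    then have "p i * exp t \<le> \<theta>0 * exp t" by simp
    then show "p i * exp t \<le> \<theta>" using \<theta>(1) by (rule order.trans)
    show "0 < p i" using a[OF that] z by (simp add: p_def)
  qed
  have q: "0 < q j" "q j * exp t \<le> \<theta>" if "j \<in> {1..n}" for j
  proof -
    have "q j * exp t \<le> \<theta>0 * exp t" using b[OF that] by (simp add: q_def)
    then show "q j * exp t \<le> \<theta>" using \<theta>(1) by (rule order.trans)
    show "0 < q j" using b[OF that] z by (simp add: q_def)
  qed
  let ?\<rho> = "\<lambda>q. (1 - q * exp (- t)) / (1 - q * exp t)"
  define K where "K = 8 / (1 - \<theta>) ^ 3 * t ^ 3"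
  have e2: "exp (2 * t) * exp (- t) = exp t" "exp t / exp (2 * t) = exp (- t)"
    by (simp_all add: exp_add [symmetric] exp_diff [symmetric])
  have "measure P {\<omega>\<in>space P. x \<le> real (last_passage (\<lambda>i j. W i j \<omega>) m n)}
    \<le> exp (2 * t) powr (- x) * (\<Prod>i=1..m. (1 - p i * exp (- t)) / (1 - exp (2 * t) * (p i * exp (- t))))
      * (\<Prod>j=1..n. (1 - q j * exp t / exp (2 * t)) / (1 - q j * exp t))"
  proof (rule last_passage_tail[OF W mn])
    show "1 \<le> exp (2 * t)" using t by simp
    show "a i * b j = p i * exp (- t) * (q j * exp t)" for i j
      using z by (simp add: p_def q_def exp_minus field_simps)
    show "0 < p i * exp (- t) \<and> exp (2 * t) * (p i * exp (- t)) < 1" if "i \<in> {1..m}" for i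
      using p[OF that] \<theta> by (simp add: mult.left_commute[of "exp (2 * t)"] e2)
    show "0 < q j * exp t \<and> q j * exp t < 1" if "j \<in> {1..n}" for j
      using q[OF that] \<theta> by simp
  qed
  also have "\<dots> = exp (- 2 * t * x) * (\<Prod>i=1..m. ?\<rho> (p i)) * (\<Prod>j=1..n. ?\<rho> (q j))"
  proof -
    have "exp (2 * t) * (p i * exp (- t)) = p i * exp t" for i
      by (simp add: mult.left_commute[of "exp (2 * t)"] e2)
    moreover have "q j * exp t / exp (2 * t) = q j * exp (- t)" for j
      by (simp add: e2 flip: times_divide_eq_right)
    moreover have "exp (2 * t) powr (- x) = exp (- 2 * t * x)"
      by (simp add: powr_def)
    ultimately show ?thesis
      by (simp only:)
  qed
  also have "\<dots> \<le> exp (- 2 * t * x) * (\<Prod>i=1..m. exp (2 * t * (p i / (1 - p i)) + K))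
      * (\<Prod>j=1..n. exp (2 * t * (q j / (1 - q j)) + K))"
  proof -
    have nonneg: "0 \<le> ?\<rho> y" if "0 < y" "y * exp t \<le> \<theta>" for y
    proof -
      have "y * exp (- t) \<le> y * exp t" using that t by simp
      then have "y * exp (- t) \<le> 1" "y * exp t \<le> 1" using that \<theta> by linarith+
      then show ?thesis by simp
    qed
    show ?thesis
      unfolding K_def using p q t \<theta> nonneg
      by (intro mult_mono mult_nonneg_nonneg prod_mono prod_nonneg conjI ratio_bound ballI) auto
  qed
  also have "\<dots> = exp (- 2 * t * x + (\<Sum>i=1..m. 2 * t * (p i / (1 - p i)) + K)
      + (\<Sum>j=1..n. 2 * t * (q j / (1 - q j)) + K))"
    by (simp only: exp_sum exp_add finite_atLeastAtMost)
  also have "(\<Sum>i=1..m. 2 * t * (p i / (1 - p i)) + K) = 2 * t * (\<Sum>i=1..m. a i / (z - a i)) + real m * K"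
  proof -
    have "p i / (1 - p i) = a i / (z - a i)" for i
      using z by (cases "a i = z") (auto simp: p_def field_simps)
    then show ?thesis by (simp add: sum.distrib sum_distrib_left)
  qed
  also have "(\<Sum>j=1..n. 2 * t * (q j / (1 - q j)) + K) = 2 * t * (\<Sum>j=1..n. b j * z / (1 - b j * z)) + real n * K"
    by (simp add: q_def sum.distrib sum_distrib_left)
  also have "- 2 * t * x + (2 * t * (\<Sum>i=1..m. a i / (z - a i)) + real m * K)
      + (2 * t * (\<Sum>j=1..n. b j * z / (1 - b j * z)) + real n * K)
    = - 2 * t * x + 2 * t * (real n * g_fun a b m n z) + (real m + real n) * K"
    using mn by (simp add: g_fun_def algebra_simps)
  finally show ?thesis
    by (simp add: K_def)
qed

text \<open>
  The exponent is \<open>- 2 t n s\<close> plus a cubic error of at most \<open>n K t\<^sup>3\<close>. Taking \<open>t\<close> of order \<open>sqrt s\<close> for small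
  \<open>s\<close> lets the linear term absorb the error, whence the power \<open>3/2\<close>; for large \<open>s\<close> the range of \<open>t\<close> is
  exhausted and the decay is linear.
\<close>

lemma last_passage_tail_above:
  assumes W: "geometric_weights P W a b" and mn: "1 \<le> m" "1 \<le> n"
    and a: "\<And>i. i \<in> {1..m} \<Longrightarrow> 0 < a i \<and> a i \<le> \<theta>0 * z"
    and b: "\<And>j. j \<in> {1..n} \<Longrightarrow> 0 < b j \<and> b j * z \<le> \<theta>0"
    and z: "0 < z" and \<delta>: "0 < \<delta>" "\<delta> \<le> 1" and \<theta>: "0 \<le> \<theta>0" "\<theta>0 * exp \<delta> \<le> \<theta>" "\<theta> < 1"
    and R: "real m \<le> R * real n" and s: "0 < s"
    and K: "K = (R + 1) * (8 / (1 - \<theta>) ^ 3)"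
  shows "measure P {\<omega>\<in>space P. real n * g_fun a b m n z + real n * s
        \<le> real (last_passage (\<lambda>i j. W i j \<omega>) m n)}
    \<le> exp (- min \<delta> (1 / sqrt K) * real n * min (s powr (3/2)) s)"
proof -
  have "0 < R * real n"
    using R mn by linarith
  then have "0 < R"
    using mn by (simp add: zero_less_mult_iff)
  then have K0: "0 < K"
    using \<theta> by (simp add: K)
  define t where "t = min \<delta> (sqrt (s / K))"
  have t: "0 \<le> t" "t \<le> \<delta>" "t \<le> 1"
    using \<delta> s K0 by (auto simp: t_def)
  have "t\<^sup>2 \<le> (sqrt (s / K))\<^sup>2"
    using t by (intro power_mono) (auto simp: t_def)
  then have Kt: "K * t\<^sup>2 \<le> s"
    using s K0 by (simp add: field_simps)
  have rate: "min \<delta> (1 / sqrt K) * min (s powr (3/2)) s \<le> t * s"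
  proof (cases "\<delta> \<le> sqrt (s / K)")
    case True
    then show ?thesis
      using \<delta> s K0 by (auto simp: t_def intro!: mult_mono)
  next
    case False
    have "s powr (3/2) = s powr (1 + 1/2)" by simp
    also have "\<dots> = s * sqrt s"
      using s by (subst powr_add) (simp add: powr_half_sqrt)
    finally have "1 / sqrt K * s powr (3/2) = t * s"
      using False by (simp add: t_def real_sqrt_divide)
    moreover have "min \<delta> (1 / sqrt K) * min (s powr (3/2)) s \<le> 1 / sqrt K * s powr (3/2)"
      using \<delta> s K0 by (intro mult_mono) auto
    ultimately show ?thesis by simp
  qed
  have "measure P {\<omega>\<in>space P. real n * g_fun a b m n z + real n * s
        \<le> real (last_passage (\<lambda>i j. W i j \<omega>) m n)}
    \<le> exp (- 2 * t * (real n * g_fun a b m n z + real n * s) + 2 * t * (real n * g_fun a b m n z)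
      + (real m + real n) * (8 / (1 - \<theta>) ^ 3 * t ^ 3))"
  proof (rule last_passage_tail_exp[OF W mn a b z t(1) t(3) _ \<theta>(3)])
    have "\<theta>0 * exp t \<le> \<theta>0 * exp \<delta>"
      using t \<theta> by (intro mult_left_mono) auto
    then show "\<theta>0 * exp t \<le> \<theta>" using \<theta> by simp
  qed
  also have "\<dots> \<le> exp (- min \<delta> (1 / sqrt K) * real n * min (s powr (3/2)) s)"
  proof -
    have "(real m + real n) * (8 / (1 - \<theta>) ^ 3 * t ^ 3) \<le> ((R + 1) * real n) * (8 / (1 - \<theta>) ^ 3 * t ^ 3)"
      using R t \<theta> by (intro mult_right_mono) (auto simp: algebra_simps)
    also have "\<dots> = real n * t * (K * t\<^sup>2)"
      by (simp add: K power3_eq_cube power2_eq_square)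
    also have "\<dots> \<le> real n * t * s"
      using Kt t by (intro mult_left_mono) auto
    finally have "(real m + real n) * (8 / (1 - \<theta>) ^ 3 * t ^ 3) \<le> real n * (t * s)"
      by (simp add: mult_ac)
    moreover have "real n * (min \<delta> (1 / sqrt K) * min (s powr (3/2)) s) \<le> real n * (t * s)"
      using rate by (intro mult_left_mono) auto
    ultimately show ?thesis
      by (simp add: algebra_simps)
  qed
  finally show ?thesis .
qed

section \<open>Location of the minimizer\<close>

lemma reciprocal_tangent:
  fixes x y :: real
  assumes "0 < x" "0 < y"
  shows "1 / y \<ge> 1 / x - (y - x) / x\<^sup>2"
proof -
  have "1 / y - (1 / x - (y - x) / x\<^sup>2) = (y - x)\<^sup>2 / (y * x\<^sup>2)"
    using assms by (simp add: field_simps power2_eq_square)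
  also have "\<dots> \<ge> 0" using assms by simp
  finally show ?thesis by simp
qed

lemma g_fun_tangent:
  assumes n: "1 \<le> n"
    and a: "\<And>i. i \<in> {1..m} \<Longrightarrow> 0 < a i \<and> a i < x \<and> a i < y"
    and b: "\<And>j. j \<in> {1..n} \<Longrightarrow> b j * x < 1 \<and> b j * y < 1"
  shows "g_fun a b m n y \<ge> g_fun a b m n x
    + (y - x) * (((\<Sum>j=1..n. b j / (1 - b j * x)\<^sup>2) - (\<Sum>i=1..m. a i / (x - a i)\<^sup>2)) / real n)"
proof -
  have A: "a i / (x - a i) - (y - x) * (a i / (x - a i)\<^sup>2) \<le> a i / (y - a i)" if "i \<in> {1..m}" for i
  proof -
    have "a i * (1 / (x - a i) - ((y - a i) - (x - a i)) / (x - a i)\<^sup>2) \<le> a i * (1 / (y - a i))"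
      using a[OF that] by (intro mult_left_mono reciprocal_tangent) auto
    then show ?thesis by (simp add: algebra_simps)
  qed
  have B: "b j * x / (1 - b j * x) + (y - x) * (b j / (1 - b j * x)\<^sup>2) \<le> b j * y / (1 - b j * y)"
    if "j \<in> {1..n}" for j
  proof -
    have "1 / (1 - b j * x) - ((1 - b j * y) - (1 - b j * x)) / (1 - b j * x)\<^sup>2 \<le> 1 / (1 - b j * y)"
      using b[OF that] by (intro reciprocal_tangent) auto
    moreover have "b j * x / (1 - b j * x) = 1 / (1 - b j * x) - 1" "b j * y / (1 - b j * y) = 1 / (1 - b j * y) - 1"
      using b[OF that] by (auto simp: field_simps)
    moreover have "((1 - b j * y) - (1 - b j * x)) / (1 - b j * x)\<^sup>2 = - ((y - x) * (b j / (1 - b j * x)\<^sup>2))"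
      using minus_divide_left[of "b j * y - b j * x" "(1 - b j * x)\<^sup>2"] by (simp add: algebra_simps)
    ultimately show ?thesis by linarith
  qed
  have "(\<Sum>i=1..m. a i / (x - a i) - (y - x) * (a i / (x - a i)\<^sup>2))
      + (\<Sum>j=1..n. b j * x / (1 - b j * x) + (y - x) * (b j / (1 - b j * x)\<^sup>2))
      \<le> (\<Sum>i=1..m. a i / (y - a i)) + (\<Sum>j=1..n. b j * y / (1 - b j * y))"
    by (intro add_mono sum_mono A B)
  then have "((\<Sum>i=1..m. a i / (x - a i)) + (\<Sum>j=1..n. b j * x / (1 - b j * x))
      + (y - x) * ((\<Sum>j=1..n. b j / (1 - b j * x)\<^sup>2) - (\<Sum>i=1..m. a i / (x - a i)\<^sup>2))) / real n
      \<le> ((\<Sum>i=1..m. a i / (y - a i)) + (\<Sum>j=1..n. b j * y / (1 - b j * y))) / real n"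
    by (intro divide_right_mono) (simp_all add: sum.distrib sum_subtractf sum_distrib_left algebra_simps)
  then show ?thesis
    by (simp add: g_fun_def add_divide_distrib)
qed

text \<open>
  Every summand of \<open>g\<close> is convex, so \<open>g\<close> lies above its tangents at \<open>z1\<close> and \<open>z2\<close>. The hypotheses give the
  signs of the two slopes; hence outside the compact interval spanned by these points \<open>g\<close> is no smaller
  than at one of them.
\<close>

lemma gamma_inf_attained:
  assumes mn: "1 \<le> m" "1 \<le> n"
    and a: "\<And>i. i \<in> {1..m} \<Longrightarrow> 0 < a i \<and> a i < z1 \<and> a i < z2"
    and b: "\<And>j. j \<in> {1..n} \<Longrightarrow> 0 < b j \<and> b j * z1 < 1 \<and> b j * z2 < 1"
    and left: "(\<Sum>j=1..n. b j / (1 - b j * z1)\<^sup>2) \<le> (\<Sum>i=1..m. a i / (z1 - a i)\<^sup>2)"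
    and right: "(\<Sum>i=1..m. a i / (z2 - a i)\<^sup>2) \<le> (\<Sum>j=1..n. b j / (1 - b j * z2)\<^sup>2)"
  shows "\<exists>z\<in>{min z1 z2..max z1 z2}. gamma_inf a b m n = g_fun a b m n z"
proof -
  define D where "D = {Max (a ` {1..m})<..<Min ((\<lambda>j. 1 / b j) ` {1..n})}"
  have D: "x \<in> D \<longleftrightarrow> (\<forall>i\<in>{1..m}. a i < x) \<and> (\<forall>j\<in>{1..n}. b j * x < 1)" for x
    unfolding D_def using mn b by (auto simp: field_simps)
  let ?I = "{min z1 z2..max z1 z2}"
  have I: "x \<in> D" if "x \<in> ?I" for x
  proof -
    have "b j * x < 1" if "j \<in> {1..n}" for j
    proof -
      have "b j * x \<le> b j * max z1 z2"
        using \<open>x \<in> ?I\<close> b[OF that] by (intro mult_left_mono) auto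
      also have "\<dots> < 1"
        using b[OF that] by (simp add: max_def)
      finally show ?thesis .
    qed
    then show ?thesis
      using that a by (force simp: D)
  qed
  have "continuous_on ?I (g_fun a b m n)"
    unfolding g_fun_def using I[unfolded D] by (intro continuous_intros) (auto, force+)
  then obtain z where z: "z \<in> ?I" "\<And>x. x \<in> ?I \<Longrightarrow> g_fun a b m n z \<le> g_fun a b m n x"
  proof -
    have "?I \<noteq> {}" by simp
    then show ?thesis
      using that continuous_attains_inf[OF compact_Icc _ \<open>continuous_on ?I (g_fun a b m n)\<close>] by blast
  qed
  have "g_fun a b m n z \<le> g_fun a b m n x" if x: "x \<in> D" for x
  proof -
    consider "x \<in> ?I" | "x < min z1 z2" | "max z1 z2 < x" by fastforce
    then show ?thesis
    proof cases
      case 2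
      have "g_fun a b m n z \<le> g_fun a b m n z1"
        by (intro z) auto
      also have "\<dots> \<le> g_fun a b m n x"
      proof -
        have "0 \<le> (x - z1) * (((\<Sum>j=1..n. b j / (1 - b j * z1)\<^sup>2) - (\<Sum>i=1..m. a i / (z1 - a i)\<^sup>2)) / real n)"
          using 2 left by (intro mult_nonpos_nonpos divide_nonpos_nonneg) auto
        moreover have "g_fun a b m n x \<ge> g_fun a b m n z1
          + (x - z1) * (((\<Sum>j=1..n. b j / (1 - b j * z1)\<^sup>2) - (\<Sum>i=1..m. a i / (z1 - a i)\<^sup>2)) / real n)"
          using a b x D by (intro g_fun_tangent mn) auto
        ultimately show ?thesis by linarith
      qed
      finally show ?thesis .
    next
      case 3
      have "g_fun a b m n z \<le> g_fun a b m n z2"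
        by (intro z) auto
      also have "\<dots> \<le> g_fun a b m n x"
      proof -
        have "0 \<le> (x - z2) * (((\<Sum>j=1..n. b j / (1 - b j * z2)\<^sup>2) - (\<Sum>i=1..m. a i / (z2 - a i)\<^sup>2)) / real n)"
          using 3 right by (intro mult_nonneg_nonneg divide_nonneg_nonneg) auto
        moreover have "g_fun a b m n x \<ge> g_fun a b m n z2
          + (x - z2) * (((\<Sum>j=1..n. b j / (1 - b j * z2)\<^sup>2) - (\<Sum>i=1..m. a i / (z2 - a i)\<^sup>2)) / real n)"
          using a b x D by (intro g_fun_tangent mn) auto
        ultimately show ?thesis by linarith
      qed
      finally show ?thesis .
    qed (auto intro: z)
  qed
  then have "(INF x\<in>D. g_fun a b m n x) = g_fun a b m n z"
    using I[OF z(1)] by (intro cInf_eq_minimum) auto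
  then show ?thesis
    using z(1) by (auto simp: gamma_inf_def D_def)
qed

section \<open>An ergodic theorem\<close>

text \<open>
  The maximum of the first \<open>n\<close> ergodic sums and of \<open>0\<close>, in the recursive form on which Garsia's
  proof of the maximal ergodic theorem rests.
\<close>

primrec max_ergodic_sum :: "('a \<Rightarrow> real) \<Rightarrow> ('a \<Rightarrow> 'a) \<Rightarrow> nat \<Rightarrow> 'a \<Rightarrow> real" where
  "max_ergodic_sum g T 0 x = 0"
| "max_ergodic_sum g T (Suc n) x = max 0 (g x + max_ergodic_sum g T n (T x))"

lemma max_ergodic_sum_nonneg: "0 \<le> max_ergodic_sum g T n x"
  by (cases n) auto

lemma max_ergodic_sum_Suc_le: "max_ergodic_sum g T n x \<le> max_ergodic_sum g T (Suc n) x"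
  by (induction n arbitrary: x) (auto intro: max.coboundedI2)

lemma max_ergodic_sum_mono: "n \<le> k \<Longrightarrow> max_ergodic_sum g T n x \<le> max_ergodic_sum g T k x"
  by (rule lift_Suc_mono_le[of "\<lambda>n. max_ergodic_sum g T n x"]) (rule max_ergodic_sum_Suc_le)

lemma max_ergodic_sum_ge: "(\<Sum>k<n. g ((T ^^ k) x)) \<le> max_ergodic_sum g T n x"
proof (induction n arbitrary: x)
  case (Suc n)
  have "(\<Sum>k<Suc n. g ((T ^^ k) x)) = g x + (\<Sum>k<n. g ((T ^^ k) (T x)))"
    by (simp add: sum.lessThan_Suc_shift funpow_swap1 del: sum.lessThan_Suc)
  also have "\<dots> \<le> g x + max_ergodic_sum g T n (T x)"
    using Suc.IH[of "T x"] by simp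
  finally show ?case by simp
qed simp

text \<open>
  Garsia's argument: where the maximum \<open>M (n + 1)\<close> is positive, \<open>g = M (n + 1) - M n \<circ> T\<close>, and elsewhere
  \<open>M (n + 1) - M n \<circ> T \<le> 0\<close>. So the integral of \<open>g\<close> over the set where the maximum is positive is at least that of
  \<open>M (n + 1) - M n\<close>, by invariance of the measure, and the maxima increase. The sets exhaust the space.
\<close>

lemma maximal_ergodic:
  fixes g :: "'a \<Rightarrow> real"
  assumes N: "prob_space N" and T: "T \<in> measurable N N" "distr N N T = N"
    and g: "integrable N g"
    and pos: "AE x in N. \<exists>n. 0 < (\<Sum>k<n. g ((T ^^ k) x))"
  shows "0 \<le> (\<integral>x. g x \<partial>N)"
proof -
  let ?M = "max_ergodic_sum g T"
  have [measurable]: "T \<in> measurable N N" "g \<in> borel_measurable N"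
    using T g by auto
  have M_int: "integrable N (?M n)" for n
  proof (induction n)
    case (Suc n)
    have "integrable (distr N N T) (?M n)"
      using Suc T(2) by simp
    then have "integrable N (\<lambda>x. ?M n (T x))"
      by (rule integrable_distr[OF T(1)])
    then show ?case
      using g by (auto intro!: integrable_max)
  qed simp
  have M_shift: "integrable N (\<lambda>x. ?M n (T x))" "(\<integral>x. ?M n (T x) \<partial>N) = (\<integral>x. ?M n x \<partial>N)" for n
  proof -
    have "integrable (distr N N T) (?M n)"
      using M_int T(2) by simp
    then show "integrable N (\<lambda>x. ?M n (T x))"
      by (rule integrable_distr[OF T(1)])
    have "(\<integral>x. ?M n x \<partial>distr N N T) = (\<integral>x. ?M n (T x) \<partial>N)"
      using M_int[of n] by (intro integral_distr T(1)) auto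
    then show "(\<integral>x. ?M n (T x) \<partial>N) = (\<integral>x. ?M n x \<partial>N)"
      using T(2) by simp
  qed
  define A where "A = (\<lambda>n. {x\<in>space N. 0 < ?M (Suc n) x})"
  have A[measurable]: "A n \<in> sets N" for n
    unfolding A_def using borel_measurable_integrable[OF M_int[of "Suc n"]] by measurable
  have gA_int: "integrable N (\<lambda>x. indicator (A n) x * g x)" for n
    using integrable_mult_indicator[OF A g] by simp
  have "0 \<le> (\<integral>x. indicator (A n) x * g x \<partial>N)" for n
  proof -
    have "(\<integral>x. ?M n x \<partial>N) \<le> (\<integral>x. ?M (Suc n) x \<partial>N)"
      by (intro integral_mono M_int max_ergodic_sum_Suc_le)
    then have "0 \<le> (\<integral>x. ?M (Suc n) x - ?M n (T x) \<partial>N)"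
      using M_int[of "Suc n"] M_shift[of n] by (simp del: max_ergodic_sum.simps)
    also have "\<dots> \<le> (\<integral>x. indicator (A n) x * g x \<partial>N)"
    proof (rule integral_mono)
      show "integrable N (\<lambda>x. ?M (Suc n) x - ?M n (T x))"
        using M_int[of "Suc n"] M_shift[of n] by (intro Bochner_Integration.integrable_diff)
      show "integrable N (\<lambda>x. indicator (A n) x * g x)"
        by (rule gA_int)
      show "?M (Suc n) x - ?M n (T x) \<le> indicator (A n) x * g x" if "x \<in> space N" for x
        using that max_ergodic_sum_nonneg[of g T n "T x"] by (auto simp: A_def indicator_def max_def)
    qed
    finally show ?thesis .
  qed
  moreover have "(\<lambda>n. \<integral>x. indicator (A n) x * g x \<partial>N) \<longlonglongrightarrow> (\<integral>x. g x \<partial>N)"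
  proof (rule integral_dominated_convergence)
    show "integrable N (\<lambda>x. \<bar>g x\<bar>)"
      using g by simp
    show "AE x in N. (\<lambda>n. indicator (A n) x * g x) \<longlonglongrightarrow> g x"
      using pos AE_space
    proof eventually_elim
      case (elim x)
      then obtain n where n: "0 < (\<Sum>k<n. g ((T ^^ k) x))" by blast
      have "eventually (\<lambda>k. 0 < ?M (Suc k) x) sequentially"
        using eventually_ge_at_top[of n]
      proof eventually_elim
        fix k assume "n \<le> k"
        then have "?M n x \<le> ?M (Suc k) x"
          by (intro max_ergodic_sum_mono) simp
        then show "0 < ?M (Suc k) x"
          using n max_ergodic_sum_ge[of g T x n] by linarith
      qed
      then have "eventually (\<lambda>k. indicator (A k) x * g x = g x) sequentially"
        by (rule eventually_mono) (use elim(2) in \<open>auto simp: A_def\<close>)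
      then show ?case
        by (rule tendsto_eventually)
    qed
  qed (auto simp: indicator_def)
  ultimately show ?thesis
    by (intro LIMSEQ_le_const) auto
qed

lemma seq_shift_measurable[measurable]: "seq_shift \<in> measurable seq_space seq_space"
  unfolding seq_shift_def seq_space_def by measurable

lemma component_measurable: "i \<ge> 1 \<Longrightarrow> (\<lambda>x. x i) \<in> borel_measurable seq_space"
  unfolding seq_space_def by (rule measurable_component_singleton) simp

lemma seq_shift_funpow: "i \<ge> 1 \<Longrightarrow> (seq_shift ^^ k) x i = x (i + k)"
  by (induction k arbitrary: i) (simp_all add: seq_shift_def)

lemma seq_shift_space: "seq_shift x \<in> space seq_space"
  by (simp add: seq_shift_def seq_space_def space_PiM)

definition seq_average :: "(real \<Rightarrow> real) \<Rightarrow> (nat \<Rightarrow> real) \<Rightarrow> nat \<Rightarrow> real" where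
  "seq_average f x n = (\<Sum>i=1..n. f (x i)) / real n"

lemma seq_average_measurable:
  assumes [measurable]: "f \<in> borel_measurable borel"
  shows "(\<lambda>x. seq_average f x n) \<in> borel_measurable seq_space"
proof -
  have [measurable]: "(\<lambda>x. f (x i)) \<in> borel_measurable seq_space" if "i \<in> {1..n}" for i
    using component_measurable[of i] that by (intro measurable_compose[OF _ assms]) auto
  show ?thesis
    unfolding seq_average_def by measurable
qed

lemma limsup_seq_average_shift:
  assumes f: "\<And>t. \<bar>f t\<bar> \<le> B"
  shows "limsup (\<lambda>n. ereal (seq_average f (seq_shift x) n)) = limsup (\<lambda>n. ereal (seq_average f x n))"
proof -
  define d where "d = (\<lambda>n. (f (x (n + 1)) - f (x 1)) / real n)"
  have "(\<Sum>i=1..n. f (seq_shift x i)) = (\<Sum>i=1..n. f (x i)) + (f (x (n + 1)) - f (x 1))" for n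
    by (induction n) (simp_all add: seq_shift_def)
  then have split: "seq_average f (seq_shift x) n = d n + seq_average f x n" for n
    by (simp add: seq_average_def d_def add_divide_distrib)
  have "d \<longlonglongrightarrow> 0"
  proof (rule Lim_null_comparison)
    have "\<bar>f (x (n + 1)) - f (x 1)\<bar> \<le> 2 * B" for n
      using f[of "x 1"] f[of "x (n + 1)"] by linarith
    then show "\<forall>\<^sub>F n in sequentially. norm (d n) \<le> 2 * B / real n"
      by (intro always_eventually allI) (simp add: d_def divide_right_mono)
    show "(\<lambda>n. 2 * B / real n) \<longlonglongrightarrow> 0"
      by (rule lim_const_over_n)
  qed
  then have "(\<lambda>n. ereal (d n)) \<longlonglongrightarrow> ereal 0"
    by simp
  from ereal_limsup_lim_add[OF this, of "\<lambda>n. ereal (seq_average f x n)"] show ?thesis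
    by (simp add: split)
qed

text \<open>
  The set where the limsup exceeds \<open>c\<close> is shift invariant. Were its measure one, the maximal ergodic
  theorem for \<open>f (x 1) - c\<close> would give \<open>c \<le> \<integral> f (x 1)\<close>.
\<close>

lemma limsup_seq_average_le:
  assumes \<nu>: "prob_space \<nu>" "sets \<nu> = sets seq_space" "stationary_law \<nu>" "ergodic_law \<nu>"
    and f: "f \<in> borel_measurable borel" "\<And>t. \<bar>f t\<bar> \<le> B"
    and c: "(\<integral>x. f (x 1) \<partial>\<nu>) < c"
  shows "AE x in \<nu>. limsup (\<lambda>n. ereal (seq_average f x n)) \<le> ereal c"
proof -
  interpret prob_space \<nu> by (fact \<nu>)
  note [measurable] = f(1) seq_average_measurable[OF f(1)]
  have sets_eq[measurable_cong]: "sets \<nu> = sets seq_space" by (fact \<nu>)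
  have space_eq: "space \<nu> = space seq_space"
    using sets_eq by (rule sets_eq_imp_space_eq)
  define E where "E = {x\<in>space seq_space. ereal c < limsup (\<lambda>n. ereal (seq_average f x n))}"
  have E[measurable]: "E \<in> sets seq_space"
    unfolding E_def by measurable
  have "seq_shift -` E \<inter> space seq_space = E"
    using limsup_seq_average_shift[of f B, OF f(2)] seq_shift_space by (auto simp: E_def)
  then have E01: "measure \<nu> E = 0 \<or> measure \<nu> E = 1"
    using \<nu>(4) E by (auto simp: ergodic_law_def)
  have "measure \<nu> E \<noteq> 1"
  proof
    assume "measure \<nu> E = 1"
    then have AE_E: "AE x in \<nu>. x \<in> E"
      by (subst (asm) prob_eq_1) (auto simp: sets_eq)
    have f1[measurable]: "(\<lambda>x. f (x 1)) \<in> borel_measurable seq_space"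
      by (intro measurable_compose[OF component_measurable f(1)]) simp
    have f_int: "integrable \<nu> (\<lambda>x. f (x 1))"
      using f(2) f1 by (intro integrable_const_bound[of _ B]) (auto simp: measurable_cong_sets[OF sets_eq refl])
    have "0 \<le> (\<integral>x. f (x 1) - c \<partial>\<nu>)"
    proof (rule maximal_ergodic[OF \<nu>(1)])
      show "seq_shift \<in> measurable \<nu> \<nu>"
        using seq_shift_measurable by (simp add: measurable_cong_sets[OF sets_eq sets_eq])
      show "distr \<nu> \<nu> seq_shift = \<nu>"
        using \<nu>(3) distr_cong[OF refl sets_eq, of \<nu> seq_shift seq_shift] by (simp add: stationary_law_def)
      show "integrable \<nu> (\<lambda>x. f (x 1) - c)"
        using f_int by simp
      show "AE x in \<nu>. \<exists>n. 0 < (\<Sum>k<n. f ((seq_shift ^^ k) x 1) - c)"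
        using AE_E
      proof eventually_elim
        case (elim x)
        have "\<exists>n. n > 0 \<and> c < seq_average f x n"
        proof (rule ccontr)
          assume "\<not> ?thesis"
          then have "\<forall>\<^sub>F n in sequentially. ereal (seq_average f x n) \<le> ereal c"
            by (intro eventually_mono[OF eventually_gt_at_top[of 0]]) (metis not_less ereal_less_eq(3))
          then have "limsup (\<lambda>n. ereal (seq_average f x n)) \<le> ereal c"
            by (rule Limsup_bounded)
          then show False
            using elim by (simp add: E_def not_less [symmetric])
        qed
        then obtain n where n: "n > 0" "c < seq_average f x n" by blast
        have "(\<Sum>k<n. f ((seq_shift ^^ k) x 1) - c) = (\<Sum>k<n. f (x (Suc k))) - real n * c"
          by (simp add: seq_shift_funpow sum_subtractf)
        also have "(\<Sum>k<n. f (x (Suc k))) = (\<Sum>i=1..n. f (x i))"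
          by (rule sum.reindex_bij_witness[of _ "\<lambda>i. i - 1" Suc]) auto
        finally show ?case
          using n by (intro exI[of _ n]) (simp add: seq_average_def field_simps)
      qed
    qed
    also have "\<dots> = (\<integral>x. f (x 1) \<partial>\<nu>) - c"
      using f_int by (simp add: prob_space)
    finally show False
      using c by simp
  qed
  then have "AE x in \<nu>. x \<notin> E"
    using E01 E by (subst prob_eq_0 [symmetric]) (auto simp: sets_eq)
  then show ?thesis
    using AE_space by eventually_elim (auto simp: E_def space_eq not_less)
qed

text \<open>
  Birkhoff's theorem for bounded functions of one coordinate; the lower bound is the upper one for \<open>- f\<close>.
\<close>

lemma ergodic_seq_average:
  assumes \<nu>: "prob_space \<nu>" "sets \<nu> = sets seq_space" "stationary_law \<nu>" "ergodic_law \<nu>"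
    and f: "f \<in> borel_measurable borel" "\<And>t. \<bar>f t\<bar> \<le> B"
  shows "AE x in \<nu>. seq_average f x \<longlonglongrightarrow> (\<integral>x. f (x 1) \<partial>\<nu>)"
proof -
  have upper: "AE x in \<nu>. \<forall>k. limsup (\<lambda>n. ereal (seq_average h x n)) \<le> ereal ((\<integral>x. h (x 1) \<partial>\<nu>) + 1 / real (Suc k))"
    if "h \<in> borel_measurable borel" "\<And>t. \<bar>h t\<bar> \<le> B" for h
    unfolding AE_all_countable by (intro allI limsup_seq_average_le[OF \<nu> that]) auto
  have f': "(\<lambda>t. - f t) \<in> borel_measurable borel" "\<And>t. \<bar>- f t\<bar> \<le> B"
    using f by auto
  show ?thesis
    using upper[OF f] upper[OF f']
  proof eventually_elim
    case (elim x)
    let ?I = "\<integral>x. f (x 1) \<partial>\<nu>"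
    show ?case
    proof (rule order_tendstoI)
      fix y assume "?I < y"
      then obtain k where "1 / real (Suc k) < y - ?I"
        using reals_Archimedean[of "y - ?I"] by (auto simp: inverse_eq_divide)
      then have "limsup (\<lambda>n. ereal (seq_average f x n)) < ereal y"
        using elim(1)[rule_format, of k] by (auto elim!: le_less_trans)
      then show "\<forall>\<^sub>F n in sequentially. seq_average f x n < y"
        by (auto dest: Limsup_lessD)
    next
      fix y assume "y < ?I"
      then obtain k where "1 / real (Suc k) < ?I - y"
        using reals_Archimedean[of "?I - y"] by (auto simp: inverse_eq_divide)
      then have "limsup (\<lambda>n. ereal (seq_average (\<lambda>t. - f t) x n)) < ereal (- y)"
        using elim(2)[rule_format, of k] by (auto elim!: le_less_trans)
      then have "\<forall>\<^sub>F n in sequentially. seq_average (\<lambda>t. - f t) x n < - y"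
        by (auto dest: Limsup_lessD)
      then show "\<forall>\<^sub>F n in sequentially. y < seq_average f x n"
        by (simp add: seq_average_def sum_negf)
    qed
  qed
qed

section \<open>The two thresholds\<close>

text \<open>
  The complement of the support is covered by the countably many basic open sets of measure zero.
\<close>

lemma AE_measure_support:
  assumes "sets \<mu> = sets (borel :: real measure)"
  shows "AE x in \<mu>. x \<in> measure_support \<mu>"
proof -
  obtain \<B> :: "real set set" where \<B>: "countable \<B>" "topological_basis \<B>"
    using ex_countable_basis by blast
  define \<N> where "\<N> = {U\<in>\<B>. emeasure \<mu> U = 0}"
  have null: "U \<in> null_sets \<mu>" if "U \<in> \<N>" for U
    using that topological_basis_open[OF \<B>(2)] by (auto simp: \<N>_def null_sets_def assms)
  have "countable \<N>"
    using \<B>(1) by (auto simp: \<N>_def)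
  then have "\<Union>\<N> \<in> null_sets \<mu>"
    using null_sets_UN'[of \<N> id \<mu>] null by simp
  then show ?thesis
  proof (rule AE_I', intro subsetI, goal_cases)
    case (1 x)
    then obtain U where U: "open U" "x \<in> U" "emeasure \<mu> U = 0"
      by (auto simp: measure_support_def zero_less_iff_neq_zero)
    then obtain V where V: "V \<in> \<B>" "x \<in> V" "V \<subseteq> U"
      using topological_basisE[OF \<B>(2)] by metis
    have "emeasure \<mu> V \<le> emeasure \<mu> U"
      using U V by (intro emeasure_mono) (auto simp: assms)
    then show ?case
      using U V by (auto simp: \<N>_def)
  qed
qed

lemma right_endpoint_unit:
  assumes \<mu>: "prob_space \<mu>" "sets \<mu> = sets borel" and unit: "AE x in \<mu>. 0 < x \<and> x < 1"
  shows "AE x in \<mu>. x \<le> right_endpoint \<mu>" and "0 < right_endpoint \<mu>" and "right_endpoint \<mu> \<le> 1"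
proof -
  interpret prob_space \<mu> by (fact \<mu>)
  have le1: "x \<le> 1" if "x \<in> measure_support \<mu>" for x
  proof (rule ccontr)
    assume "\<not> x \<le> 1"
    then have "emeasure \<mu> {1<..} > 0"
      using that by (auto simp: measure_support_def)
    moreover have "emeasure \<mu> {1<..} = 0"
    proof -
      have "AE x in \<mu>. x \<notin> {1<..}"
        using unit by eventually_elim simp
      then have "{1<..} \<in> null_sets \<mu>"
        by (intro AE_iff_null_sets[THEN iffD2]) (auto simp: \<mu>(2))
      then show ?thesis by auto
    qed
    ultimately show False by simp
  qed
  have le: "x \<le> right_endpoint \<mu>" if "x \<in> measure_support \<mu>" for x
    unfolding right_endpoint_def using that le1 by (intro cSup_upper bdd_aboveI[of _ 1])
  show AE_le: "AE x in \<mu>. x \<le> right_endpoint \<mu>"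
    using AE_measure_support[OF \<mu>(2)] by eventually_elim (rule le)
  have "AE x in \<mu>. x \<in> measure_support \<mu> \<and> 0 < x \<and> x < 1"
    using AE_measure_support[OF \<mu>(2)] unit by eventually_elim simp
  then have "\<exists>x. x \<in> measure_support \<mu> \<and> 0 < x \<and> x < 1"
    by (metis (mono_tags, lifting) AE_contr eventually_mono)
  then obtain x where x: "x \<in> measure_support \<mu>" "0 < x"
    by blast
  then show "0 < right_endpoint \<mu>"
    using le[OF x(1)] by simp
  show "right_endpoint \<mu> \<le> 1"
    unfolding right_endpoint_def using x le1 by (intro cSup_least) auto
qed

text \<open>
  One \<open>a i\<close> contributes \<open>- pole_above A z (a i)\<close> to \<open>n g'(z)\<close>, and one \<open>b j\<close> contributes
  \<open>pole_below B z (b j)\<close> (defined next). The cutoff outside the interval that carries the law makes them bounded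
  functions on the whole line as long as the pole lies outside this interval, as the ergodic theorem requires.
\<close>

definition pole_above :: "real \<Rightarrow> real \<Rightarrow> real \<Rightarrow> real" where
  "pole_above A z t = (if 0 \<le> t \<and> t \<le> A then t / (z - t)\<^sup>2 else 0)"

definition pole_below :: "real \<Rightarrow> real \<Rightarrow> real \<Rightarrow> real" where
  "pole_below B z t = (if 0 \<le> t \<and> t \<le> B then t / (1 - t * z)\<^sup>2 else 0)"

lemma pole_above_measurable[measurable]: "pole_above A z \<in> borel_measurable borel"
  unfolding pole_above_def by measurable

lemma pole_below_measurable[measurable]: "pole_below B z \<in> borel_measurable borel"
  unfolding pole_below_def by measurable

lemma pole_above_nonneg: "0 \<le> pole_above A z t"
  by (auto simp: pole_above_def)

lemma pole_below_nonneg: "0 \<le> pole_below B z t"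
  by (auto simp: pole_below_def)

lemma pole_above_bounded: "0 \<le> A \<Longrightarrow> A < z \<Longrightarrow> \<bar>pole_above A z t\<bar> \<le> A / (z - A)\<^sup>2"
  by (auto simp: pole_above_def intro!: frac_le power_mono)

lemma pole_below_bounded:
  assumes "0 \<le> B" "0 \<le> z" "z \<le> w" "B * w < 1"
  shows "\<bar>pole_below B z t\<bar> \<le> B / (1 - B * w)\<^sup>2"
proof -
  have "t * z \<le> B * w" if "0 \<le> t" "t \<le> B"
    using assms that by (intro mult_mono) auto
  then show ?thesis
    using assms by (auto simp: pole_below_def intro!: frac_le power_mono)
qed

text \<open>
  A strict inequality between derivatives at the endpoint \<open>A\<close> persists at some \<open>z > A\<close>. As \<open>z\<close> decreases to
  \<open>A\<close>, the left integral converges by dominated convergence. The right one may be infinite at \<open>A\<close>, where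
  Fatou's lemma bounds it by the lower limit of the integrals at \<open>z\<close>.
\<close>

lemma threshold_parameter:
  assumes \<alpha>: "prob_space \<alpha>" "sets \<alpha> = sets borel" "AE x in \<alpha>. 0 < x \<and> x < 1"
    and \<beta>: "prob_space \<beta>" "sets \<beta> = sets borel" "AE x in \<beta>. 0 < x \<and> x < 1"
    and A: "A = right_endpoint \<alpha>" and B: "B = right_endpoint \<beta>" and AB: "A * B < 1" and r: "0 < r"
    and less: "(\<integral>\<^sup>+b\<in>{0..1}. (ennreal b / ennreal ((1 - b * A)\<^sup>2)) \<partial>\<beta>)
      < ennreal r * (\<integral>\<^sup>+a\<in>{0..1}. (ennreal a / ennreal ((A - a)\<^sup>2)) \<partial>\<alpha>)"
  shows "\<exists>z>A. z * B < 1 \<and> (\<integral>b. pole_below B z b \<partial>\<beta>) < r * (\<integral>a. pole_above A z a \<partial>\<alpha>)"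
proof (rule ccontr)
  assume none: "\<not> ?thesis"
  interpret \<alpha>: prob_space \<alpha> by (fact \<alpha>)
  interpret \<beta>: prob_space \<beta> by (fact \<beta>)
  have [measurable_cong]: "sets \<alpha> = sets borel" "sets \<beta> = sets borel"
    by (fact \<alpha> \<beta>)+
  note A_props = right_endpoint_unit[OF \<alpha>, folded A] and B_props = right_endpoint_unit[OF \<beta>, folded B]
  \<comment> \<open>Half the gap keeps \<open>(A + \<epsilon>) B < 1\<close>, as \<open>B \<le> 1\<close>.\<close>
  define \<epsilon> where "\<epsilon> = (1 - A * B) / 2"
  have \<epsilon>: "0 < \<epsilon>" using AB by (simp add: \<epsilon>_def)
  define z where "z = (\<lambda>k. A + \<epsilon> / real (Suc k))"
  have z: "A < z k" "z k \<le> A + \<epsilon>" for k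
    using \<epsilon> by (auto simp: z_def field_simps)
  have "\<epsilon> * B \<le> \<epsilon> * 1"
    using \<epsilon> B_props by (intro mult_left_mono) auto
  then have top: "B * (A + \<epsilon>) < 1"
  proof -
    assume "\<epsilon> * B \<le> \<epsilon> * 1"
    then have "B * (A + \<epsilon>) \<le> A * B + \<epsilon>"
      by (simp add: algebra_simps)
    also have "\<dots> < 1"
    proof -
      have "x + (1 - x) / 2 < 1" if "x < 1" for x :: real
        using that by (simp add: field_simps)
      then show ?thesis using AB by (simp add: \<epsilon>_def)
    qed
    finally show ?thesis .
  qed
  have zB: "z k * B < 1" for k
    using mult_left_mono[OF z(2)[of k] less_imp_le[OF B_props(2)]] top by (simp add: mult.commute)
  have z_lim: "z \<longlonglongrightarrow> A"
    unfolding z_def using tendsto_add[OF tendsto_const LIMSEQ_Suc[OF lim_const_over_n[of \<epsilon>]], of A]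
    by simp
  define N D where "N = (\<lambda>w. \<integral>b. pole_below B w b \<partial>\<beta>)" and "D = (\<lambda>k. \<integral>a. pole_above A (z k) a \<partial>\<alpha>)"
  \<comment> \<open>If no parameter works, then the reverse inequality holds at every \<open>z k\<close> and passes to the limit.\<close>
  have DN: "D k \<le> N (z k) / r" for k
  proof -
    have "\<not> N (z k) < r * D k"
      using none z(1)[of k] zB[of k] unfolding N_def D_def by blast
    then show ?thesis
      using r by (simp add: field_simps)
  qed
  have "(\<lambda>k. N (z k)) \<longlonglongrightarrow> N A"
    unfolding N_def
  proof (rule integral_dominated_convergence)
    show "AE b in \<beta>. (\<lambda>k. pole_below B (z k) b) \<longlonglongrightarrow> pole_below B A b"
    proof (intro AE_I2)
      fix b
      show "(\<lambda>k. pole_below B (z k) b) \<longlonglongrightarrow> pole_below B A b"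
      proof (cases "0 \<le> b \<and> b \<le> B")
        case True
        then have "b * A \<le> B * A"
          using A_props by (intro mult_right_mono) auto
        then have "(1 - b * A)\<^sup>2 \<noteq> 0"
          using AB by (simp add: mult.commute)
        then show ?thesis
          using True by (auto simp: pole_below_def intro!: tendsto_intros z_lim)
      qed (auto simp: pole_below_def)
    qed
    show "AE b in \<beta>. norm (pole_below B (z k) b) \<le> B / (1 - B * (A + \<epsilon>))\<^sup>2" for k
      using B_props A_props z[of k] top by (intro AE_I2) (auto intro!: pole_below_bounded)
  qed auto
  then have N_lim: "(\<lambda>k. ennreal (N (z k) / r)) \<longlonglongrightarrow> ennreal (N A / r)"
    using r by (intro tendsto_ennrealI tendsto_divide) auto
  have num: "(\<integral>\<^sup>+b\<in>{0..1}. (ennreal b / ennreal ((1 - b * A)\<^sup>2)) \<partial>\<beta>) = ennreal (N A)"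
  proof -
    have "(\<integral>\<^sup>+b\<in>{0..1}. (ennreal b / ennreal ((1 - b * A)\<^sup>2)) \<partial>\<beta>) = (\<integral>\<^sup>+b. ennreal (pole_below B A b) \<partial>\<beta>)"
    proof (rule nn_integral_cong_AE)
      show "AE b in \<beta>. ennreal b / ennreal ((1 - b * A)\<^sup>2) * indicator {0..1} b = ennreal (pole_below B A b)"
        using \<beta>(3) B_props(1)
      proof eventually_elim
        case (elim b)
        then have "b * A \<le> B * A"
          using A_props by (intro mult_right_mono) auto
        then have "0 < (1 - b * A)\<^sup>2"
          using AB by (simp add: mult.commute)
        then show ?case
          using elim by (simp add: pole_below_def divide_ennreal)
      qed
    qed
    also have "\<dots> = ennreal (N A)"
    proof -
      have "\<bar>pole_below B A b\<bar> \<le> B / (1 - B * A)\<^sup>2" for b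
        using B_props A_props AB by (intro pole_below_bounded) (auto simp: mult.commute)
      then show ?thesis
        unfolding N_def
        by (intro nn_integral_eq_integral \<beta>.integrable_const_bound[of _ "B / (1 - B * A)\<^sup>2"] AE_I2)
          (simp_all add: pole_below_nonneg)
    qed
    finally show ?thesis .
  qed
  have "(\<integral>\<^sup>+a\<in>{0..1}. (ennreal a / ennreal ((A - a)\<^sup>2)) \<partial>\<alpha>)
      \<le> (\<integral>\<^sup>+a. liminf (\<lambda>k. ennreal (pole_above A (z k) a)) \<partial>\<alpha>)"
  proof (rule nn_integral_mono_AE)
    show "AE a in \<alpha>. ennreal a / ennreal ((A - a)\<^sup>2) * indicator {0..1} a
        \<le> liminf (\<lambda>k. ennreal (pole_above A (z k) a))"
      using \<alpha>(3) A_props(1)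
    proof eventually_elim
      case (elim a)
      have "(\<lambda>k. ennreal (pole_above A (z k) a)) \<longlonglongrightarrow> ennreal a / ennreal ((A - a)\<^sup>2)"
      proof (cases "a = A")
        case True
        have "filterlim (\<lambda>k. A * (real (Suc k) / \<epsilon>)\<^sup>2) at_top sequentially"
        proof (rule filterlim_tendsto_pos_mult_at_top[OF tendsto_const A_props(2)])
          have "filterlim (\<lambda>k. real (Suc k) * (1 / \<epsilon>)) at_top sequentially"
            using \<epsilon> filterlim_compose[OF filterlim_real_sequentially filterlim_Suc]
            by (intro filterlim_at_top_mult_tendsto_pos[OF tendsto_const]) auto
          then show "filterlim (\<lambda>k. (real (Suc k) / \<epsilon>)\<^sup>2) at_top sequentially"
            by (intro filterlim_pow_at_top) auto
        qed
        moreover have "pole_above A (z k) a = A * (real (Suc k) / \<epsilon>)\<^sup>2" for k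
          using True elim by (simp add: pole_above_def z_def power_divide)
        ultimately have "(\<lambda>k. ennreal (pole_above A (z k) a)) \<longlonglongrightarrow> top"
          by (subst ennreal_tendsto_top_eq_at_top) (simp only:)
        then show ?thesis
          using True elim by simp
      next
        case False
        then have "0 < (A - a)\<^sup>2" by simp
        then show ?thesis
          using elim False
          by (auto simp: pole_above_def divide_ennreal intro!: tendsto_intros z_lim)
      qed
      then have "liminf (\<lambda>k. ennreal (pole_above A (z k) a)) = ennreal a / ennreal ((A - a)\<^sup>2)"
        by (intro lim_imp_Liminf) auto
      then show ?case
        by (simp add: indicator_def)
    qed
  qed
  also have "\<dots> \<le> liminf (\<lambda>k. \<integral>\<^sup>+a. ennreal (pole_above A (z k) a) \<partial>\<alpha>)"
    by (intro nn_integral_liminf) measurable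
  also have "(\<lambda>k. \<integral>\<^sup>+a. ennreal (pole_above A (z k) a) \<partial>\<alpha>) = (\<lambda>k. ennreal (D k))"
  proof
    fix k
    show "(\<integral>\<^sup>+a. ennreal (pole_above A (z k) a) \<partial>\<alpha>) = ennreal (D k)"
      unfolding D_def using pole_above_bounded[OF less_imp_le[OF A_props(2)] z(1)[of k]]
      by (intro nn_integral_eq_integral \<alpha>.integrable_const_bound[of _ "A / (z k - A)\<^sup>2"] AE_I2)
        (simp_all add: pole_above_nonneg)
  qed
  also have "liminf (\<lambda>k. ennreal (D k)) \<le> liminf (\<lambda>k. ennreal (N (z k) / r))"
    using DN by (intro Liminf_mono always_eventually allI ennreal_leI)
  also have "\<dots> = ennreal (N A / r)"
    using N_lim by (intro lim_imp_Liminf) auto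
  finally have "ennreal r * (\<integral>\<^sup>+a\<in>{0..1}. (ennreal a / ennreal ((A - a)\<^sup>2)) \<partial>\<alpha>) \<le> ennreal r * ennreal (N A / r)"
    by (rule mult_left_mono) simp
  also have "\<dots> = ennreal (N A)"
    using r by (simp add: ennreal_mult' [symmetric])
  finally show False
    using less num by simp
qed

lemma nn_integral_pole_pos:
  assumes "prob_space \<mu>" "sets \<mu> = sets borel" "AE x in \<mu>. 0 < x \<and> x < 1"
  shows "(\<integral>\<^sup>+a\<in>{0..1}. (ennreal a / ennreal ((A - a)\<^sup>2)) \<partial>\<mu>) \<noteq> 0"
proof
  interpret prob_space \<mu> by (fact assms)
  have [measurable_cong]: "sets \<mu> = sets borel" by (fact assms)
  assume "(\<integral>\<^sup>+a\<in>{0..1}. (ennreal a / ennreal ((A - a)\<^sup>2)) \<partial>\<mu>) = 0"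
  then have "AE a in \<mu>. ennreal a / ennreal ((A - a)\<^sup>2) * indicator {0..1} a = 0"
    by (subst (asm) nn_integral_0_iff_AE) auto
  with assms(3) have "AE a in \<mu>. False"
    by eventually_elim (auto simp: indicator_def)
  then show False by simp
qed

lemma nn_integral_below_finite:
  assumes \<mu>: "prob_space \<mu>" "sets \<mu> = sets borel" "AE x in \<mu>. 0 < x \<and> x < 1"
    and z: "0 \<le> z" "z * right_endpoint \<mu> < 1"
  shows "(\<integral>\<^sup>+b\<in>{0..1}. (ennreal b / ennreal ((1 - b * z)\<^sup>2)) \<partial>\<mu>) < top"
proof -
  interpret prob_space \<mu> by (fact \<mu>)
  define B where "B = right_endpoint \<mu>"
  note B = right_endpoint_unit[OF \<mu>, folded B_def]
  have "(\<integral>\<^sup>+b\<in>{0..1}. (ennreal b / ennreal ((1 - b * z)\<^sup>2)) \<partial>\<mu>) \<le> (\<integral>\<^sup>+b. ennreal (1 / (1 - B * z)\<^sup>2) \<partial>\<mu>)"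
  proof (rule nn_integral_mono_AE)
    show "AE b in \<mu>. ennreal b / ennreal ((1 - b * z)\<^sup>2) * indicator {0..1} b \<le> ennreal (1 / (1 - B * z)\<^sup>2)"
      using \<mu>(3) B(1)
    proof eventually_elim
      case (elim b)
      then have "b * z \<le> B * z"
        using z by (intro mult_right_mono) auto
      then have "0 < 1 - B * z" "1 - B * z \<le> 1 - b * z"
        using z by (auto simp: B_def mult.commute)
      then have "b / (1 - b * z)\<^sup>2 \<le> 1 / (1 - B * z)\<^sup>2"
        using elim by (intro frac_le power_mono) auto
      moreover have "0 < (1 - b * z)\<^sup>2"
        using \<open>0 < 1 - B * z\<close> \<open>1 - B * z \<le> 1 - b * z\<close> by simp
      ultimately show ?case
        using elim by (simp add: divide_ennreal ennreal_leI)
    qed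
  qed
  also have "\<dots> < top"
    by (simp add: emeasure_space_1)
  finally show ?thesis .
qed

text \<open>
  Division is by a nonzero, possibly infinite number; the numerator is finite because
  \<open>1 - b z\<close> stays away from \<open>0\<close> on the support.
\<close>

lemma c1_less_imp:
  assumes \<alpha>: "prob_space \<alpha>" "sets \<alpha> = sets borel" "AE x in \<alpha>. 0 < x \<and> x < 1"
    and \<beta>: "prob_space \<beta>" "sets \<beta> = sets borel" "AE x in \<beta>. 0 < x \<and> x < 1"
    and AB: "right_endpoint \<alpha> * right_endpoint \<beta> < 1" and r: "c1 \<alpha> \<beta> < ennreal r"
  shows "(\<integral>\<^sup>+b\<in>{0..1}. (ennreal b / ennreal ((1 - b * right_endpoint \<alpha>)\<^sup>2)) \<partial>\<beta>)
      < ennreal r * (\<integral>\<^sup>+a\<in>{0..1}. (ennreal a / ennreal ((right_endpoint \<alpha> - a)\<^sup>2)) \<partial>\<alpha>)"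
proof -
  have "x < ennreal r * y" if "x / y < ennreal r" "y \<noteq> 0" "x < top" for x y :: ennreal
  proof (cases "y = top")
    case True
    then show ?thesis
      using that by (auto simp: ennreal_mult_top)
  next
    case False
    then have "x / y * y < ennreal r * y"
      using that by (intro ennreal_mult_strict_right_mono) (auto simp: less_top zero_less_iff_neq_zero)
    then show ?thesis
      using that False by (simp add: ennreal_divide_times less_top)
  qed
  then show ?thesis
    using r nn_integral_pole_pos[OF \<alpha>, of "right_endpoint \<alpha>"]
      nn_integral_below_finite[OF \<beta>, of "right_endpoint \<alpha>"] right_endpoint_unit(2)[OF \<alpha>] AB
    by (simp add: c1_def)
qed

text \<open>
  This is the hypothesis of \<open>threshold_parameter\<close> with the two laws exchanged and \<open>r\<close>
  replaced by \<open>1 / r\<close>, the symmetry of the model under transposition and \<open>z \<mapsto> 1 / z\<close>.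
\<close>

lemma less_c2_imp:
  assumes \<alpha>: "prob_space \<alpha>" "sets \<alpha> = sets borel" "AE x in \<alpha>. 0 < x \<and> x < 1"
    and \<beta>: "prob_space \<beta>" "sets \<beta> = sets borel" "AE x in \<beta>. 0 < x \<and> x < 1"
    and AB: "right_endpoint \<alpha> * right_endpoint \<beta> < 1" and r: "0 < r" "ennreal r < c2 \<alpha> \<beta>"
  shows "(\<integral>\<^sup>+a\<in>{0..1}. (ennreal a / ennreal ((1 - a * right_endpoint \<beta>)\<^sup>2)) \<partial>\<alpha>)
      < ennreal (1 / r) * (\<integral>\<^sup>+b\<in>{0..1}. (ennreal b / ennreal ((right_endpoint \<beta> - b)\<^sup>2)) \<partial>\<beta>)"
proof -
  have "y < ennreal (1 / r) * x" if *: "ennreal r < x / y" "y < top" for x y :: ennreal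
  proof (cases x y rule: ennreal2_cases)
    case (real_real x' y')
    show ?thesis
    proof (cases "y' = 0")
      case True
      then show ?thesis
        using * r real_real by (auto simp: ennreal_mult' [symmetric] ennreal_zero_less_mult_iff split: if_splits)
    next
      case False
      then have "r < x' / y'"
        using * r real_real by (simp add: divide_ennreal ennreal_less_iff)
      then have "y' < 1 / r * x'"
        using r False real_real by (simp add: field_simps)
      then show ?thesis
        using r real_real by (simp add: ennreal_mult' [symmetric] ennreal_less_iff)
    qed
  next
    case top_real
    then show ?thesis
      using r by (simp add: ennreal_mult_top)
  qed (use * in auto)
  moreover have "right_endpoint \<beta> * right_endpoint \<alpha> < 1"
    using AB by (simp add: mult.commute)
  ultimately show ?thesis
    using r nn_integral_below_finite[OF \<alpha>, of "right_endpoint \<beta>"] right_endpoint_unit(2)[OF \<beta>]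
    by (simp add: c2_def)
qed

section \<open>Typical realizations\<close>

lemma stationary_coordinate:
  assumes \<nu>: "sets \<nu> = sets seq_space" "stationary_law \<nu>" and i: "1 \<le> i"
  shows "distr \<nu> borel (\<lambda>x. x i) = distr \<nu> borel (\<lambda>x. x 1)"
  using i
proof (induction i rule: dec_induct)
  case (step i)
  have "distr \<nu> borel (\<lambda>x. x i) = distr (distr \<nu> seq_space seq_shift) borel (\<lambda>x. x i)"
    using \<nu> by (simp add: stationary_law_def)
  also have "\<dots> = distr \<nu> borel ((\<lambda>x. x i) \<circ> seq_shift)"
    using step seq_shift_measurable component_measurable[of i]
    by (intro distr_distr) (auto simp: measurable_cong_sets[OF \<nu>(1) refl])
  also have "(\<lambda>x. x i) \<circ> seq_shift = (\<lambda>x. x (Suc i))"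
    using step by (auto simp: seq_shift_def)
  finally show ?case
    using step by simp
qed simp

lemma typical_sequence:
  fixes \<nu> :: "(nat \<Rightarrow> real) measure"
  defines "\<mu> \<equiv> distr \<nu> borel (\<lambda>x. x 1)"
  assumes \<nu>: "prob_space \<nu>" "sets \<nu> = sets seq_space" "stationary_law \<nu>" "ergodic_law \<nu>"
  shows "AE t in \<mu>. Q t \<Longrightarrow> AE x in \<nu>. \<forall>i\<ge>1. Q (x i)"
    and "f \<in> borel_measurable borel \<Longrightarrow> (\<And>t. \<bar>f t\<bar> \<le> B) \<Longrightarrow>
      AE x in \<nu>. seq_average f x \<longlonglongrightarrow> (\<integral>t. f t \<partial>\<mu>)"
proof -
  have meas: "(\<lambda>x. x i) \<in> measurable \<nu> borel" if "1 \<le> i" for i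
    using component_measurable[OF that] by (simp add: measurable_cong_sets[OF \<nu>(2) refl])
  show "AE x in \<nu>. \<forall>i\<ge>1. Q (x i)" if Q: "AE t in \<mu>. Q t"
  proof -
    have "AE x in \<nu>. 1 \<le> i \<longrightarrow> Q (x i)" for i
    proof (cases "1 \<le> i")
      case True
      then have "AE t in distr \<nu> borel (\<lambda>x. x i). Q t"
        unfolding stationary_coordinate[OF \<nu>(2,3) True] using Q by (simp only: \<mu>_def)
      then show ?thesis
        using AE_distrD[OF meas[OF True]] by (auto elim: eventually_mono)
    qed simp
    then show ?thesis
      by (simp add: AE_all_countable)
  qed
  show "AE x in \<nu>. seq_average f x \<longlonglongrightarrow> (\<integral>t. f t \<partial>\<mu>)"
    if f: "f \<in> borel_measurable borel" "\<And>t. \<bar>f t\<bar> \<le> B"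
  proof -
    have "(\<integral>t. f t \<partial>\<mu>) = (\<integral>x. f (x 1) \<partial>\<nu>)"
      unfolding \<mu>_def using f meas[of 1] by (intro integral_distr) auto
    then show ?thesis
      using ergodic_seq_average[OF \<nu> f] by simp
  qed
qed

lemma unit_seqs_measurable: "unit_seqs \<in> sets seq_space"
  unfolding unit_seqs_def seq_space_def by (intro sets_PiM_I_countable) auto

lemma seq_average_ratio:
  assumes avg: "seq_average f x \<longlonglongrightarrow> F" and r: "(0::real) < r"
    and n: "filterlim n at_top sequentially"
    and mn: "(\<lambda>k. real (m k) / real (n k)) \<longlonglongrightarrow> r"
  shows "(\<lambda>k. (\<Sum>i=1..m k. f (x i)) / real (n k)) \<longlonglongrightarrow> r * F"
proof -
  have n': "filterlim (\<lambda>k. real (n k)) at_top sequentially"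
    using n by (rule filterlim_compose[OF filterlim_real_sequentially])
  have "filterlim (\<lambda>k. real (m k) / real (n k) * real (n k)) at_top sequentially"
    using mn r n' by (rule filterlim_tendsto_pos_mult_at_top)
  moreover have "\<forall>\<^sub>F k in sequentially. real (m k) / real (n k) * real (n k) = real (m k)"
    using filterlim_at_top_dense[THEN iffD1, OF n', rule_format, of 0] by eventually_elim simp
  ultimately have "filterlim (\<lambda>k. real (m k)) at_top sequentially"
    by (simp add: filterlim_cong)
  then have "filterlim m at_top sequentially"
    by (simp add: filterlim_sequentially_iff_filterlim_real)
  then have "(\<lambda>k. real (m k) / real (n k) * seq_average f x (m k)) \<longlonglongrightarrow> r * F"
    by (intro tendsto_mult mn filterlim_compose[OF avg])
  moreover have "real (m k) / real (n k) * seq_average f x (m k) = (\<Sum>i=1..m k. f (x i)) / real (n k)" for k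
    by (simp add: seq_average_def)
  ultimately show ?thesis by (simp only:)
qed

lemma eventually_less_of_tendsto:
  fixes f g :: "nat \<Rightarrow> real"
  assumes "f \<longlonglongrightarrow> a" "g \<longlonglongrightarrow> b" "a < b"
  shows "\<forall>\<^sub>F k in sequentially. f k < g k"
proof -
  obtain c where "a < c" "c < b" using dense[OF assms(3)] by blast
  then show ?thesis
    using order_tendstoD(2)[OF assms(1), of c] order_tendstoD(1)[OF assms(2), of c]
    by (auto elim: eventually_elim2)
qed

section \<open>The tail bound along the sequence\<close>

theorem mainTheorem6:
  fixes M :: "'e measure" and a b :: "'e \<Rightarrow> nat \<Rightarrow> real"
    and P :: "(nat \<Rightarrow> real) \<Rightarrow> (nat \<Rightarrow> real) \<Rightarrow> 'w measure"
    and W :: "nat \<Rightarrow> nat \<Rightarrow> 'w \<Rightarrow> nat"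
    and \<alpha> \<beta> :: "real measure" and r :: real and m n :: "nat \<Rightarrow> nat"
  assumes "prob_space M"
    and "a \<in> measurable M seq_space" and "b \<in> measurable M seq_space"
    and "\<And>\<omega>. \<omega> \<in> space M \<Longrightarrow> a \<omega> \<in> unit_seqs"
    and "\<And>\<omega>. \<omega> \<in> space M \<Longrightarrow> b \<omega> \<in> unit_seqs"
    and "stationary_law (distr M seq_space a)" and "ergodic_law (distr M seq_space a)"
    and "stationary_law (distr M seq_space b)" and "ergodic_law (distr M seq_space b)"
    and "\<And>x y. x \<in> unit_seqs \<Longrightarrow> y \<in> unit_seqs \<Longrightarrow> geometric_weights (P x y) W x y"
    and "\<alpha> = distr M borel (\<lambda>\<omega>. a \<omega> 1)" and "\<beta> = distr M borel (\<lambda>\<omega>. b \<omega> 1)"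
    and "right_endpoint \<alpha> * right_endpoint \<beta> < 1"
    and "c1 \<alpha> \<beta> < ennreal r" and "ennreal r < c2 \<alpha> \<beta>"
    and "\<And>k. k \<ge> 1 \<Longrightarrow> m k \<ge> 1" and "\<And>k. k \<ge> 1 \<Longrightarrow> n k \<ge> 1"
    and "filterlim n at_top sequentially"
    and "(\<lambda>k. real (m k) / real (n k)) \<longlonglongrightarrow> r"
  shows "\<exists>C>0. \<exists>c>0.
    AE (x, y) in distr M (seq_space \<Otimes>\<^sub>M seq_space) (\<lambda>\<omega>. (a \<omega>, b \<omega>)).
      \<exists>k0\<ge>1. \<forall>s>0. \<forall>k\<ge>k0.
        measure (P x y)
          {\<omega>\<in>space (P x y). real (last_passage (\<lambda>i j. W i j \<omega>) (m k) (n k))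
             \<ge> real (n k) * gamma_inf x y (m k) (n k) + real (n k) * s}
        \<le> C * exp (- c * real (n k) * min (s powr (3/2)) s)"
proof -
  interpret M: prob_space M by (fact assms(1))
  note a = assms(2) and b = assms(3) and W = assms(10)
  define \<nu>a \<nu>b where "\<nu>a = distr M seq_space a" and "\<nu>b = distr M seq_space b"
  have \<nu>a: "prob_space \<nu>a" "sets \<nu>a = sets seq_space" "stationary_law \<nu>a" "ergodic_law \<nu>a"
    and \<nu>b: "prob_space \<nu>b" "sets \<nu>b = sets seq_space" "stationary_law \<nu>b" "ergodic_law \<nu>b"
    using assms(6-9) M.prob_space_distr a b by (simp_all add: \<nu>a_def \<nu>b_def)
  have marginal: "distr M borel (\<lambda>\<omega>. h \<omega> 1) = distr (distr M seq_space h) borel (\<lambda>x. x 1)"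
    if "h \<in> measurable M seq_space" for h
    using that component_measurable[of 1] by (subst distr_distr) (auto simp: o_def)
  have \<alpha>_def: "\<alpha> = distr \<nu>a borel (\<lambda>x. x 1)" and \<beta>_def: "\<beta> = distr \<nu>b borel (\<lambda>x. x 1)"
    using assms(11,12) marginal a b by (simp_all add: \<nu>a_def \<nu>b_def)
  have unit: "prob_space \<nu>" "sets \<nu> = sets borel" "AE t in \<nu>. 0 < t \<and> t < 1"
    if h: "h \<in> measurable M seq_space" "\<And>\<omega>. \<omega> \<in> space M \<Longrightarrow> h \<omega> \<in> unit_seqs"
      and \<nu>: "\<nu> = distr M borel (\<lambda>\<omega>. h \<omega> 1)" for h \<nu>
  proof -
    have meas: "(\<lambda>\<omega>. h \<omega> 1) \<in> measurable M borel"
      using measurable_compose[OF h(1) component_measurable[of 1]] by simp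
    then show "prob_space \<nu>" "sets \<nu> = sets borel"
      by (simp_all add: \<nu> M.prob_space_distr)
    have "0 < h \<omega> 1 \<and> h \<omega> 1 < 1" if "\<omega> \<in> space M" for \<omega>
      using h(2)[OF that] by (auto simp: unit_seqs_def PiE_iff)
    then show "AE t in \<nu>. 0 < t \<and> t < 1"
      unfolding \<nu> using meas by (subst AE_distr_iff) (auto intro: AE_I2)
  qed
  note \<alpha> = unit[OF a assms(4,11)] and \<beta> = unit[OF b assms(5,12)]
  define A B where "A = right_endpoint \<alpha>" and "B = right_endpoint \<beta>"
  note A = right_endpoint_unit[OF \<alpha>, folded A_def] and B = right_endpoint_unit[OF \<beta>, folded B_def]
  have AB: "A * B < 1" "B * A < 1"
    using assms(13) by (simp_all add: A_def B_def mult.commute)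
  have "0 < ennreal r"
    using assms(14) by (rule le_less_trans[OF zero_le])
  then have r: "0 < r" by simp
  obtain z1 where z1: "A < z1" "z1 * B < 1"
    "(\<integral>t. pole_below B z1 t \<partial>\<beta>) < r * (\<integral>t. pole_above A z1 t \<partial>\<alpha>)"
    using threshold_parameter[OF \<alpha> \<beta> A_def B_def AB(1) r] c1_less_imp[OF \<alpha> \<beta> assms(13,14)]
    by (auto simp: A_def)
  obtain u where u: "B < u" "u * A < 1"
    "(\<integral>t. pole_below A u t \<partial>\<alpha>) < 1 / r * (\<integral>t. pole_above B u t \<partial>\<beta>)"
    using threshold_parameter[OF \<beta> \<alpha> B_def A_def AB(2), of "1 / r"] r
      less_c2_imp[OF \<alpha> \<beta> assms(13) r assms(15)]
    by (auto simp: B_def)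
  \<comment> \<open>The second parameter is found for the transposed model, where it is \<open>1 / z\<close>.\<close>
  define z2 where "z2 = 1 / u"
  have u0: "0 < u" using u B by simp
  have z2: "A < z2" "z2 * B < 1"
    using u u0 by (auto simp: z2_def field_simps)
  have r_below: "r * (\<integral>t. pole_below A u t \<partial>\<alpha>) < (\<integral>t. pole_above B u t \<partial>\<beta>)"
    using u(3) r by (simp add: field_simps)
  define zl zr where "zl = min z1 z2" and "zr = max z1 z2"
  have zlr: "A < zl" "B * zr < 1" "0 < zl" "zl \<le> zr"
    using z1 z2 A by (auto simp: zl_def zr_def max_def min_def mult.commute)
  \<comment> \<open>All ratios \<open>a i / z\<close> and \<open>b j z\<close> with \<open>z\<close> between \<open>zl\<close> and \<open>zr\<close> are at most \<open>\<theta>0\<close>; multiplied by \<open>exp \<delta>\<close> they stay below \<open>\<theta>\<close>.\<close>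
  define \<theta>0 where "\<theta>0 = max (A / zl) (B * zr)"
  have \<theta>0: "0 < \<theta>0" "\<theta>0 < 1" "A \<le> \<theta>0 * zl" "B * zr \<le> \<theta>0"
  proof -
    show "0 < \<theta>0" using A zlr by (auto simp: \<theta>0_def less_max_iff_disj)
    show "\<theta>0 < 1" using zlr by (auto simp: \<theta>0_def)
    have "A / zl \<le> \<theta>0" by (simp add: \<theta>0_def)
    then show "A \<le> \<theta>0 * zl" using zlr by (simp add: field_simps)
    show "B * zr \<le> \<theta>0" by (simp add: \<theta>0_def)
  qed
  define \<theta> where "\<theta> = (1 + \<theta>0) / 2"
  have \<theta>: "\<theta> < 1" "\<theta>0 < \<theta>" using \<theta>0 by (auto simp: \<theta>_def)
  define \<delta> where "\<delta> = min 1 (ln (\<theta> / \<theta>0))"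
  have \<delta>: "0 < \<delta>" "\<delta> \<le> 1"
    using \<theta> \<theta>0 by (auto simp: \<delta>_def)
  have "exp \<delta> \<le> exp (ln (\<theta> / \<theta>0))"
    by (simp add: \<delta>_def)
  also have "\<dots> = \<theta> / \<theta>0"
    using \<theta> \<theta>0 by simp
  finally have \<theta>0\<delta>: "\<theta>0 * exp \<delta> \<le> \<theta>"
    using \<theta>0 by (simp add: field_simps)
  define K where "K = (r + 1 + 1) * (8 / (1 - \<theta>) ^ 3)"
  have K: "0 < K" using r \<theta> by (simp add: K_def)
  define c where "c = min \<delta> (1 / sqrt K)"
  have c: "0 < c" using \<delta> K by (simp add: c_def)
  have bound: "\<exists>k0\<ge>1. \<forall>s>0. \<forall>k\<ge>k0.
        measure (P x y)
          {\<omega>\<in>space (P x y). real (last_passage (\<lambda>i j. W i j \<omega>) (m k) (n k))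
             \<ge> real (n k) * gamma_inf x y (m k) (n k) + real (n k) * s}
        \<le> 1 * exp (- c * real (n k) * min (s powr (3/2)) s)"
    if xy: "x \<in> unit_seqs" "y \<in> unit_seqs" and xA: "\<forall>i\<ge>1. x i \<le> A" and yB: "\<forall>j\<ge>1. y j \<le> B"
      and x1: "seq_average (pole_above A z1) x \<longlonglongrightarrow> (\<integral>t. pole_above A z1 t \<partial>\<alpha>)"
      and x2: "seq_average (pole_below A u) x \<longlonglongrightarrow> (\<integral>t. pole_below A u t \<partial>\<alpha>)"
      and y1: "seq_average (pole_below B z1) y \<longlonglongrightarrow> (\<integral>t. pole_below B z1 t \<partial>\<beta>)"
      and y2: "seq_average (pole_above B u) y \<longlonglongrightarrow> (\<integral>t. pole_above B u t \<partial>\<beta>)"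
    for x y
  proof -
    have x01: "0 < x i" "x i \<le> A" and y01: "0 < y i" "y i \<le> B" if "1 \<le> i" for i
      using that xy xA yB by (auto simp: unit_seqs_def PiE_iff)
    have y_avg: "(\<lambda>k. (\<Sum>j=1..n k. f (y j)) / real (n k)) \<longlonglongrightarrow> F" if "seq_average f y \<longlonglongrightarrow> F" for f F
      using filterlim_compose[OF that assms(18)] by (simp add: seq_average_def)
    have "\<forall>\<^sub>F k in sequentially. (\<Sum>j=1..n k. pole_below B z1 (y j)) / real (n k)
        < (\<Sum>i=1..m k. pole_above A z1 (x i)) / real (n k)"
      by (rule eventually_less_of_tendsto[OF y_avg[OF y1] seq_average_ratio[OF x1 r assms(18,19)] z1(3)])
    moreover have "\<forall>\<^sub>F k in sequentially. (\<Sum>i=1..m k. pole_below A u (x i)) / real (n k)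
        < (\<Sum>j=1..n k. pole_above B u (y j)) / real (n k)"
      by (rule eventually_less_of_tendsto[OF seq_average_ratio[OF x2 r assms(18,19)] y_avg[OF y2] r_below])
    moreover have "\<forall>\<^sub>F k in sequentially. real (m k) / real (n k) < r + 1"
      using order_tendstoD(2)[OF assms(19), of "r + 1"] by simp
    ultimately have "\<forall>\<^sub>F k in sequentially.
        (\<Sum>j=1..n k. pole_below B z1 (y j)) / real (n k) < (\<Sum>i=1..m k. pole_above A z1 (x i)) / real (n k) \<and>
        (\<Sum>i=1..m k. pole_below A u (x i)) / real (n k) < (\<Sum>j=1..n k. pole_above B u (y j)) / real (n k) \<and>
        real (m k) / real (n k) < r + 1"
      by eventually_elim simp
    then obtain k1 where k1: "\<And>k. k1 \<le> k \<Longrightarrow>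
        (\<Sum>j=1..n k. pole_below B z1 (y j)) / real (n k) < (\<Sum>i=1..m k. pole_above A z1 (x i)) / real (n k) \<and>
        (\<Sum>i=1..m k. pole_below A u (x i)) / real (n k) < (\<Sum>j=1..n k. pole_above B u (y j)) / real (n k) \<and>
        real (m k) / real (n k) < r + 1"
      by (auto simp: eventually_sequentially)
    show ?thesis
    proof (intro exI[of _ "max 1 k1"] conjI allI impI)
      fix s :: real and k assume s: "0 < s" and "max 1 k1 \<le> k"
      then have "1 \<le> k" "k1 \<le> k" by auto
      then have mn: "1 \<le> m k" "1 \<le> n k" using assms(16,17) by auto
      then have n0: "0 < real (n k)" by simp
      note k1' = k1[OF \<open>k1 \<le> k\<close>]
      have R: "real (m k) \<le> (r + 1) * real (n k)"
        using k1' n0 by (simp add: field_simps)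
      have left: "(\<Sum>j=1..n k. y j / (1 - y j * z1)\<^sup>2) \<le> (\<Sum>i=1..m k. x i / (z1 - x i)\<^sup>2)"
      proof -
        have "(\<Sum>j=1..n k. y j / (1 - y j * z1)\<^sup>2) = (\<Sum>j=1..n k. pole_below B z1 (y j))"
          using y01 by (intro sum.cong) (auto simp: pole_below_def less_imp_le)
        also have "\<dots> \<le> (\<Sum>i=1..m k. pole_above A z1 (x i))"
          using k1' n0 by (simp add: divide_less_cancel)
        also have "\<dots> = (\<Sum>i=1..m k. x i / (z1 - x i)\<^sup>2)"
          using x01 by (intro sum.cong) (auto simp: pole_above_def less_imp_le)
        finally show ?thesis .
      qed
      have right: "(\<Sum>i=1..m k. x i / (z2 - x i)\<^sup>2) \<le> (\<Sum>j=1..n k. y j / (1 - y j * z2)\<^sup>2)"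
      proof -
        have "x i / (z2 - x i)\<^sup>2 = u\<^sup>2 * pole_below A u (x i)" if "1 \<le> i" for i
        proof -
          have "z2 - x i = (1 - x i * u) / u"
            using u0 by (simp add: z2_def field_simps)
          then show ?thesis
            using x01[OF that] u0 by (simp add: pole_below_def power_divide)
        qed
        then have "(\<Sum>i=1..m k. x i / (z2 - x i)\<^sup>2) = u\<^sup>2 * (\<Sum>i=1..m k. pole_below A u (x i))"
          by (simp add: sum_distrib_left)
        also have "\<dots> \<le> u\<^sup>2 * (\<Sum>j=1..n k. pole_above B u (y j))"
          using k1' n0 by (intro mult_left_mono) (simp_all add: divide_less_cancel)
        also have "\<dots> = (\<Sum>j=1..n k. y j / (1 - y j * z2)\<^sup>2)"
        proof -
          have "y j / (1 - y j * z2)\<^sup>2 = u\<^sup>2 * pole_above B u (y j)" if "1 \<le> j" for j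
          proof -
            have "1 - y j * z2 = (u - y j) / u"
              using u0 by (simp add: z2_def field_simps)
            then show ?thesis
              using y01[OF that] u0 by (simp add: pole_above_def power_divide)
          qed
          then show ?thesis
            by (simp add: sum_distrib_left)
        qed
        finally show ?thesis .
      qed
      have yz: "y j * z < 1" if "1 \<le> j" "0 < z" "z * B < 1" for j z
      proof -
        have "y j * z \<le> B * z"
          using y01(2)[OF that(1)] that(2) by (intro mult_right_mono) auto
        then show ?thesis
          using that(3) by (simp add: mult.commute)
      qed
      have zpos: "0 < z1" "0 < z2"
        using z1 z2 A by auto
      obtain z where z: "zl \<le> z" "z \<le> zr" and \<gamma>: "gamma_inf x y (m k) (n k) = g_fun x y (m k) (n k) z"
      proof -
        have "\<exists>z\<in>{min z1 z2..max z1 z2}. gamma_inf x y (m k) (n k) = g_fun x y (m k) (n k) z"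
        proof (rule gamma_inf_attained[OF mn _ _ left right])
          show "0 < x i \<and> x i < z1 \<and> x i < z2" if "i \<in> {1..m k}" for i
            using that x01[of i] z1 z2 by auto
          show "0 < y j \<and> y j * z1 < 1 \<and> y j * z2 < 1" if "j \<in> {1..n k}" for j
            using that y01[of j] yz[of j] zpos z1 z2 by auto
        qed
        then show ?thesis
          using that by (auto simp: zl_def zr_def)
      qed
      show "measure (P x y)
          {\<omega>\<in>space (P x y). real (last_passage (\<lambda>i j. W i j \<omega>) (m k) (n k))
             \<ge> real (n k) * gamma_inf x y (m k) (n k) + real (n k) * s}
        \<le> 1 * exp (- c * real (n k) * min (s powr (3/2)) s)"
        unfolding \<gamma> mult_1 c_def
      proof (rule last_passage_tail_above[OF W[OF xy] mn _ _ _ \<delta> less_imp_le[OF \<theta>0(1)] \<theta>0\<delta> \<theta>(1) R s K_def])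
        show "0 < x i \<and> x i \<le> \<theta>0 * z" if "i \<in> {1..m k}" for i
        proof -
          have "\<theta>0 * zl \<le> \<theta>0 * z"
            using z \<theta>0 by (intro mult_left_mono) auto
          then have "x i \<le> \<theta>0 * z"
            using that x01(2)[of i] \<theta>0(3) by auto
          then show ?thesis
            using that x01(1)[of i] by simp
        qed
        show "0 < y j \<and> y j * z \<le> \<theta>0" if "j \<in> {1..n k}" for j
        proof -
          have "y j * z \<le> B * zr"
            using that y01[of j] z zlr B by (intro mult_mono) auto
          then show ?thesis
            using that y01[of j] \<theta>0 by auto
        qed
        show "0 < z" using z zlr by simp
      qed
    qed simp
  qed
  let ?J = "distr M (seq_space \<Otimes>\<^sub>M seq_space) (\<lambda>\<omega>. (a \<omega>, b \<omega>))"
  have ab: "(\<lambda>\<omega>. (a \<omega>, b \<omega>)) \<in> measurable M (seq_space \<Otimes>\<^sub>M seq_space)"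
    using a b by measurable
  \<comment> \<open>Going through the marginal laws avoids any question of measurability of the set of good pairs.\<close>
  have fst: "AE p in ?J. Q (fst p)" if "AE x in \<nu>a. Q x" for Q
  proof (rule AE_distrD[where M' = seq_space])
    have "distr ?J seq_space fst = \<nu>a"
      using ab by (simp add: distr_distr \<nu>a_def o_def)
    then show "AE x in distr ?J seq_space fst. Q x"
      using that by (simp only:)
  qed simp
  have snd: "AE p in ?J. Q (snd p)" if "AE y in \<nu>b. Q y" for Q
  proof (rule AE_distrD[where M' = seq_space])
    have "distr ?J seq_space snd = \<nu>b"
      using ab by (simp add: distr_distr \<nu>b_def o_def)
    then show "AE y in distr ?J seq_space snd. Q y"
      using that by (simp only:)
  qed simp
  have unit_a: "AE x in \<nu>a. x \<in> unit_seqs" and unit_b: "AE y in \<nu>b. y \<in> unit_seqs"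
    unfolding \<nu>a_def \<nu>b_def using a b assms(4,5) unit_seqs_measurable
    by (subst AE_distr_iff; auto intro!: AE_I2)+
  have leA: "AE x in \<nu>a. \<forall>i\<ge>1. x i \<le> A"
    by (rule typical_sequence(1)[OF \<nu>a]) (rule A(1)[unfolded \<alpha>_def])
  have leB: "AE y in \<nu>b. \<forall>j\<ge>1. y j \<le> B"
    by (rule typical_sequence(1)[OF \<nu>b]) (rule B(1)[unfolded \<beta>_def])
  note avg_a = typical_sequence(2)[OF \<nu>a, folded \<alpha>_def] and avg_b = typical_sequence(2)[OF \<nu>b, folded \<beta>_def]
  have avgs: "AE x in \<nu>a. seq_average (pole_above A z1) x \<longlonglongrightarrow> (\<integral>t. pole_above A z1 t \<partial>\<alpha>)"
    "AE x in \<nu>a. seq_average (pole_below A u) x \<longlonglongrightarrow> (\<integral>t. pole_below A u t \<partial>\<alpha>)"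
    "AE y in \<nu>b. seq_average (pole_below B z1) y \<longlonglongrightarrow> (\<integral>t. pole_below B z1 t \<partial>\<beta>)"
    "AE y in \<nu>b. seq_average (pole_above B u) y \<longlonglongrightarrow> (\<integral>t. pole_above B u t \<partial>\<beta>)"
  proof -
    show "AE x in \<nu>a. seq_average (pole_above A z1) x \<longlonglongrightarrow> (\<integral>t. pole_above A z1 t \<partial>\<alpha>)"
      by (rule avg_a[OF pole_above_measurable pole_above_bounded]) (use A z1 in auto)
    show "AE x in \<nu>a. seq_average (pole_below A u) x \<longlonglongrightarrow> (\<integral>t. pole_below A u t \<partial>\<alpha>)"
      by (rule avg_a[OF pole_below_measurable pole_below_bounded[of A u u]])
        (use A u u0 in \<open>auto simp: mult.commute\<close>)
    show "AE y in \<nu>b. seq_average (pole_below B z1) y \<longlonglongrightarrow> (\<integral>t. pole_below B z1 t \<partial>\<beta>)"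
      by (rule avg_b[OF pole_below_measurable pole_below_bounded[of B z1 z1]])
        (use A B z1 in \<open>auto simp: mult.commute\<close>)
    show "AE y in \<nu>b. seq_average (pole_above B u) y \<longlonglongrightarrow> (\<integral>t. pole_above B u t \<partial>\<beta>)"
      by (rule avg_b[OF pole_above_measurable pole_above_bounded]) (use B u in auto)
  qed
  have "AE (x, y) in ?J.
      \<exists>k0\<ge>1. \<forall>s>0. \<forall>k\<ge>k0.
        measure (P x y)
          {\<omega>\<in>space (P x y). real (last_passage (\<lambda>i j. W i j \<omega>) (m k) (n k))
             \<ge> real (n k) * gamma_inf x y (m k) (n k) + real (n k) * s}
        \<le> 1 * exp (- c * real (n k) * min (s powr (3/2)) s)"
    using fst[OF unit_a] snd[OF unit_b] fst[OF leA] snd[OF leB]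
      fst[OF avgs(1)] fst[OF avgs(2)] snd[OF avgs(3)] snd[OF avgs(4)]
  proof eventually_elim
    case (elim p)
    show ?case
      unfolding case_prod_beta by (rule bound[OF elim])
  qed
  then show ?thesis
    using c by (intro exI[of _ 1] conjI exI[of _ c]) auto
qed

end
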